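(* Let $A=\Bbbk Q/I$ be a string or locally string algebra over a field $\Bbbk$. For each $\Bbbk$-algebra automorphism $f\in\operatorname{Aut}(A)$, the associated graded map $\operatorname{gr} f:A\to A$ is an automorphism of $A$ (a graded one), and $$1\longrightarrow \operatorname{Aut}_0(A)\hookrightarrow \operatorname{Aut}(A)\xrightarrow{\ f\mapsto \operatorname{gr} f\ }\operatorname{grAut}(A)\longrightarrow 1$$ is a short exact sequence of groups. Moreover, if $A\not\cong \Bbbk[x]$, then $f(w)\in \operatorname{gr} f(w)+A_{>\ell(w)}$ for all $f\in \operatorname{Aut}(A)$ and all $w\in\mathcal B$.
   Context: Quivers $Q=(Q_0,Q_1,s,t)$ are finite, connected, with at least one arrow. A path of length $\ell(p)=n\ge 1$ is $p=\alpha_1\cdots\alpha_n$ with $\alpha_i\in Q_1$, $t(\alpha_i)=s(\alpha_{i+1})$; for each vertex $v$ there is a stationary path $\epsilon_v$ of length $0$. $\Bbbk Q$ is the path algebra (product = concatenation), graded by path length. $A=\Bbbk Q/I$ is a string algebra if: (i) $Q$ is finite and connected, every vertex has in-degree $\le 2$ and out-degree $\le 2$; (ii) whenever $s(\alpha)=t(\beta)=t(\beta')$ with $\beta\ne\beta'$ arrows, at least one of $\beta\alpha,\beta'\alpha$ is in $I$; (iii) whenever $t(\alpha)=s(\beta)=s(\beta')$ with $\beta\neq\beta'$, at least one of $\alpha\beta,\alpha\beta'$ is in $I$; (iv) the ideal $I$ is generated by paths (of length at least two); (v) $A$ is finite-dimensional. It is locally string if it satisfies (i)-(iv) and is infinite-dimensional.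 $\mathcal B$ is the basis of $A$ consisting of the paths not in $I$. $A_n$ is the span of paths in $\mathcal B$ of length $n$, so $A=\bigoplus_{n\ge0}A_n$ is graded; $A_{>n}=\bigoplus_{m>n}A_m$. For $f\in\operatorname{Aut}(A)$, $\operatorname{gr} f$ is the $\Bbbk$-linear graded map such that for $x\in A_n$, $\operatorname{gr} f(x)$ is the degree $n$ component of $f(x)$. $\operatorname{grAut}(A)$ is the group of graded algebra automorphisms of $A$, and $\operatorname{Aut}_0(A)=\{f\in\operatorname{Aut}(A): \operatorname{gr} f=\operatorname{id}_A\}$. *)

theory Defs
  imports
    "HOL-Computational_Algebra.Polynomial"
    "HOL-Algebra.QuotRing"
    "HOL-Algebra.Module"
    "HOL-Algebra.Bij"
    "HOL-Algebra.Exact_Sequence"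
    "Graph_Theory.Graph_Theory"
begin

hide_const (open) Polynomial.smult

section \<open>Quivers and path algebras\<close>

text \<open>
  A quiver is a finite, connected directed multigraph with at least one arrow; the source and
  target of an arrow are its \<^const>\<open>tail\<close> and \<^const>\<open>head\<close>. Connectedness refers to the underlying
  undirected graph.
\<close>

definition quiver :: "('v, 'a) pre_digraph \<Rightarrow> bool" where
  "quiver Q \<longleftrightarrow> fin_digraph Q \<and> connected Q \<and> arcs Q \<noteq> {}"

text \<open>
  A path is a pair of its start vertex and its list of arrows, written in order of traversal.
  The start vertex distinguishes the stationary paths \<open>(v, [])\<close>.
\<close>

type_synonym ('v, 'a) path = "'v \<times> 'a list"

abbreviation path_length :: "('v, 'a) path \<Rightarrow> nat" where
  "path_length w \<equiv> length (snd w)"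

definition paths :: "('v, 'a) pre_digraph \<Rightarrow> ('v, 'a) path set" where
  "paths Q = {(u, p). \<exists>v. pre_digraph.awalk Q u p v}"

text \<open>
  Elements of the path algebra are the finitely supported coefficient functions on paths. The
  product extends concatenation bilinearly: the coefficient of a path \<open>w\<close> in \<open>x y\<close> is the sum of
  \<open>x w' * y w''\<close> over all ways of cutting \<open>w\<close> into \<open>w' w''\<close>.
\<close>

definition path_algebra ::
  "('v, 'a) pre_digraph \<Rightarrow> ('k::field, ('v, 'a) path \<Rightarrow> 'k) module" where
  "path_algebra Q =
    \<lparr>carrier = {x. finite {w. x w \<noteq> 0} \<and> {w. x w \<noteq> 0} \<subseteq> paths Q},
     mult = (\<lambda>x y. \<lambda>(u, p). \<Sum>i\<le>length p.
       x (u, take i p) * y (pre_digraph.awlast Q u (take i p), drop i p)),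
     one = (\<lambda>(u, p). if u \<in> verts Q \<and> p = [] then 1 else 0),
     zero = (\<lambda>w. 0),
     add = (\<lambda>x y w. x w + y w),
     smult = (\<lambda>c x w. c * x w)\<rparr>"

definition path_elem :: "('v, 'a) path \<Rightarrow> ('v, 'a) path \<Rightarrow> 'k::field" where
  "path_elem w = (\<lambda>w'. if w' = w then 1 else 0)"


section \<open>Algebras over a field\<close>

text \<open>
  The scalars are a type of class \<^class>\<open>field\<close>; an algebra is a ring record with the additional
  scalar multiplication of \<^type>\<open>module_ext\<close>.
\<close>

definition alg_iso ::
  "('k::field, 'b) module \<Rightarrow> ('k, 'c) module \<Rightarrow> ('b \<Rightarrow> 'c) set" where
  "alg_iso A B =
    {h \<in> ring_iso A B. \<forall>c. \<forall>x \<in> carrier A. h (c \<odot>\<^bsub>A\<^esub> x) = c \<odot>\<^bsub>B\<^esub> h x}"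

definition alg_Aut :: "('k::field, 'b) module \<Rightarrow> ('b \<Rightarrow> 'b) monoid" where
  "alg_Aut A = BijGroup (carrier A) \<lparr>carrier := alg_iso A A \<inter> Bij (carrier A)\<rparr>"

definition finite_dimensional :: "('k::field, 'b) module \<Rightarrow> bool" where
  "finite_dimensional A \<longleftrightarrow> (\<exists>S. finite S \<and> S \<subseteq> carrier A \<and>
    (\<forall>a \<in> carrier A. \<exists>c. a = (\<Oplus>\<^bsub>A\<^esub>s\<in>S. c s \<odot>\<^bsub>A\<^esub> s)))"

definition polynomial_algebra :: "('k::field, 'k poly) module" where
  "polynomial_algebra =
    \<lparr>carrier = UNIV, mult = (*), one = 1, zero = 0, add = (+), smult = Polynomial.smult\<rparr>"

text \<open>
  The set \<open>c X\<close> alone is not a coset for \<open>c = 0\<close>; adding \<open>I\<close> yields \<open>c (I + x) = I + c x\<close> in all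
  cases.
\<close>

definition quotient_algebra ::
  "('k::field, 'b) module \<Rightarrow> 'b set \<Rightarrow> ('k, 'b set) module" where
  "quotient_algebra R I = ring.extend (R Quot I)
    (module.fields (\<lambda>c X. I <+>\<^bsub>R\<^esub> ((\<lambda>x. c \<odot>\<^bsub>R\<^esub> x) ` X)))"


section \<open>String algebras\<close>

definition bound_quiver_algebra ::
  "('v, 'a) pre_digraph \<Rightarrow> (('v, 'a) path \<Rightarrow> 'k::field) set \<Rightarrow>
    ('k, (('v, 'a) path \<Rightarrow> 'k) set) module" where
  "bound_quiver_algebra Q I = quotient_algebra (path_algebra Q) I"

definition string_conditions ::
  "('v, 'a) pre_digraph \<Rightarrow> (('v, 'a) path \<Rightarrow> 'k::field) set \<Rightarrow> bool" where
  "string_conditions Q I \<longleftrightarrow>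
    quiver Q \<and>
    (\<forall>v \<in> verts Q. in_degree Q v \<le> 2 \<and> out_degree Q v \<le> 2) \<and>
    (\<forall>\<alpha> \<in> arcs Q. \<forall>\<beta> \<in> arcs Q. \<forall>\<beta>' \<in> arcs Q.
      tail Q \<alpha> = head Q \<beta> \<and> tail Q \<alpha> = head Q \<beta>' \<and> \<beta> \<noteq> \<beta>' \<longrightarrow>
      path_elem (tail Q \<beta>, [\<beta>, \<alpha>]) \<in> I \<or> path_elem (tail Q \<beta>', [\<beta>', \<alpha>]) \<in> I) \<and>
    (\<forall>\<alpha> \<in> arcs Q. \<forall>\<beta> \<in> arcs Q. \<forall>\<beta>' \<in> arcs Q.
      head Q \<alpha> = tail Q \<beta> \<and> head Q \<alpha> = tail Q \<beta>' \<and> \<beta> \<noteq> \<beta>' \<longrightarrow>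
      path_elem (tail Q \<alpha>, [\<alpha>, \<beta>]) \<in> I \<or> path_elem (tail Q \<alpha>, [\<alpha>, \<beta>']) \<in> I) \<and>
    (\<exists>S \<subseteq> {w \<in> paths Q. 2 \<le> path_length w}. I = Idl\<^bsub>path_algebra Q\<^esub> (path_elem ` S))"

definition string_algebra ::
  "('v, 'a) pre_digraph \<Rightarrow> (('v, 'a) path \<Rightarrow> 'k::field) set \<Rightarrow> bool" where
  "string_algebra Q I \<longleftrightarrow>
    string_conditions Q I \<and> finite_dimensional (bound_quiver_algebra Q I)"

definition locally_string_algebra ::
  "('v, 'a) pre_digraph \<Rightarrow> (('v, 'a) path \<Rightarrow> 'k::field) set \<Rightarrow> bool" where
  "locally_string_algebra Q I \<longleftrightarrow>
    string_conditions Q I \<and> \<not> finite_dimensional (bound_quiver_algebra Q I)"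


section \<open>The grading by path length\<close>

definition basis_paths ::
  "('v, 'a) pre_digraph \<Rightarrow> (('v, 'a) path \<Rightarrow> 'k::field) set \<Rightarrow> ('v, 'a) path set" where
  "basis_paths Q I = {w \<in> paths Q. (path_elem w :: _ \<Rightarrow> 'k) \<notin> I}"

definition path_class ::
  "('v, 'a) pre_digraph \<Rightarrow> (('v, 'a) path \<Rightarrow> 'k::field) set \<Rightarrow> ('v, 'a) path \<Rightarrow>
    (('v, 'a) path \<Rightarrow> 'k) set" where
  "path_class Q I w = I +>\<^bsub>path_algebra Q\<^esub> path_elem w"

text \<open>
  \<open>graded_span Q I N\<close> is the span in \<open>A\<close> of the basis paths whose length lies in \<open>N\<close>: the
  coefficient function \<open>x\<close> is the linear combination of the paths in its support. Thus \<open>A\<^sub>n\<close> and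
  \<open>A\<^sub>>\<^sub>n\<close> are obtained for \<open>N = {n}\<close> and \<open>N = {n<..}\<close>.
\<close>

definition graded_span ::
  "('v, 'a) pre_digraph \<Rightarrow> (('v, 'a) path \<Rightarrow> 'k::field) set \<Rightarrow> nat set \<Rightarrow>
    (('v, 'a) path \<Rightarrow> 'k) set set" where
  "graded_span Q I N = {I +>\<^bsub>path_algebra Q\<^esub> x | x. x \<in> carrier (path_algebra Q) \<and>
    (\<forall>w. x w \<noteq> 0 \<longrightarrow> w \<in> basis_paths Q I \<and> path_length w \<in> N)}"

text \<open>The projection onto \<open>A\<^sub>n\<close> along the sum of the \<open>A\<^sub>m\<close> with \<open>m \<noteq> n\<close>.\<close>

definition degree_component ::
  "('v, 'a) pre_digraph \<Rightarrow> (('v, 'a) path \<Rightarrow> 'k::field) set \<Rightarrow> nat \<Rightarrow>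
    (('v, 'a) path \<Rightarrow> 'k) set \<Rightarrow> (('v, 'a) path \<Rightarrow> 'k) set" where
  "degree_component Q I n X = (THE Y. Y \<in> graded_span Q I {n} \<and>
    X \<ominus>\<^bsub>bound_quiver_algebra Q I\<^esub> Y \<in> graded_span Q I (- {n}))"

text \<open>
  The linear map sending \<open>X \<in> A\<^sub>n\<close> to the degree \<open>n\<close> component of \<open>f X\<close>, extended to sums of
  homogeneous elements.
\<close>

definition gr ::
  "('v, 'a) pre_digraph \<Rightarrow> (('v, 'a) path \<Rightarrow> 'k::field) set \<Rightarrow>
    ((('v, 'a) path \<Rightarrow> 'k) set \<Rightarrow> (('v, 'a) path \<Rightarrow> 'k) set) \<Rightarrow>
    (('v, 'a) path \<Rightarrow> 'k) set \<Rightarrow> (('v, 'a) path \<Rightarrow> 'k) set" where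
  "gr Q I f = (let A = bound_quiver_algebra Q I in
    (\<lambda>X \<in> carrier A. \<Oplus>\<^bsub>A\<^esub>n \<in> {n. degree_component Q I n X \<noteq> \<zero>\<^bsub>A\<^esub>}.
      degree_component Q I n (f (degree_component Q I n X))))"

definition grAut ::
  "('v, 'a) pre_digraph \<Rightarrow> (('v, 'a) path \<Rightarrow> 'k::field) set \<Rightarrow>
    ((('v, 'a) path \<Rightarrow> 'k) set \<Rightarrow> (('v, 'a) path \<Rightarrow> 'k) set) monoid" where
  "grAut Q I = (let G = alg_Aut (bound_quiver_algebra Q I) in
    G \<lparr>carrier := {f \<in> carrier G. \<forall>n. f ` graded_span Q I {n} = graded_span Q I {n}}\<rparr>)"

definition Aut0 ::
  "('v, 'a) pre_digraph \<Rightarrow> (('v, 'a) path \<Rightarrow> 'k::field) set \<Rightarrow>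
    ((('v, 'a) path \<Rightarrow> 'k) set \<Rightarrow> (('v, 'a) path \<Rightarrow> 'k) set) monoid" where
  "Aut0 Q I = (let A = bound_quiver_algebra Q I; G = alg_Aut A in
    G \<lparr>carrier := {f \<in> carrier G. gr Q I f = (\<lambda>X \<in> carrier A. X)}\<rparr>)"

end

theory Submission
  imports Defs
begin

text \<open>
  Write \<open>A\<close> for the bound quiver algebra. As \<open>I\<close> is generated by paths, it is spanned by paths, so an
  element of \<open>A\<close> is determined by its coefficients on the paths outside \<open>I\<close>, and multiplication is the
  concatenation product with the paths in \<open>I\<close> discarded. All computations below are done with these
  coefficients (\<open>coef\<close>); in particular the coefficient of \<open>gr f X\<close> at a path \<open>w\<close> is the coefficient at
  \<open>w\<close> of \<open>f\<close> applied to the part of \<open>X\<close> in the degree of \<open>w\<close> (\<open>coef_gr\<close>).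

  The associated graded map is functorial as soon as all automorphisms are triangular with respect to
  the degree, in one and the same direction: if every \<open>f\<close> only raises degrees, or every \<open>f\<close> only lowers
  them, then the extremal term of a product is the product of the extremal terms
  (\<open>endomorphism_gr\<close>) and the extremal term of a composite is the composite of the extremal terms
  (\<open>gr_compose\<close>). Hence \<open>gr\<close> is a homomorphism to the graded automorphisms, inverses being preserved
  because \<open>gr\<close> fixes the identity; it restricts to the identity on graded automorphisms, so it is
  onto, and its kernel is the group of automorphisms with trivial associated graded map by definition
  (\<open>graded_exact_sequence\<close>). If degrees are only raised, then \<open>f w\<close> has leading term \<open>gr f w\<close>
  (\<open>leading_term\<close>).

  To see that degrees are only raised it suffices that \<open>f\<close> maps arrows into the arrow ideal, that is,
  that \<open>f a\<close> has no component at a stationary path. The coefficient at a stationary path is a character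
  of \<open>A\<close>. Orthogonality of the idempotents \<open>e\<^sub>v\<close>, together with the fact that no nonzero idempotent lies
  in all powers of the arrow ideal, gives a bijection \<open>\<sigma>\<close> of the vertices such that \<open>f e\<^sub>v\<close> has degree
  zero part at \<open>\<sigma> v\<close> only (\<open>vertex_bijection\<close>). An arrow with distinct end points is \<open>e\<^sub>s a e\<^sub>t\<close> with
  \<open>e\<^sub>s e\<^sub>t = 0\<close>, so every character kills its image. A nilpotent loop is also killed by every character.
  If a loop \<open>a\<close> is not nilpotent and another arrow \<open>b\<close> starts or ends at the same vertex, the string
  conditions force \<open>ab = 0\<close> or \<open>ba = 0\<close>; if \<open>f a\<close> had a nonzero component at \<open>\<sigma> v\<close>, multiplying it with
  the lowest term of \<open>f b\<close> would give a nonzero result, a contradiction (\<open>loop_in_radical\<close>).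

  By connectedness the only remaining case is a quiver with a single loop and no relations. Then \<open>A\<close> is
  the polynomial algebra, the last claim is void, and an automorphism is the substitution of a
  polynomial which must have degree one; so all automorphisms preserve the degree of polynomials and
  \<open>f\<close> only lowers degrees (\<open>automorphism_preserves_degree\<close>).
\<close>


section \<open>The path algebra and its monomial ideals\<close>

lemma carrier_path_algebra:
    "carrier (path_algebra Q) = {x. finite {w. x w \<noteq> 0} \<and> {w. x w \<noteq> 0} \<subseteq> paths Q}"
  and mult_path_algebra:
    "(x \<otimes>\<^bsub>path_algebra Q\<^esub> y) (u, p) = (\<Sum>i\<le>length p.
       x (u, take i p) * y (pre_digraph.awlast Q u (take i p), drop i p))"
  and one_path_algebra:
    "\<one>\<^bsub>path_algebra Q\<^esub> = (\<lambda>(u, p). if u \<in> verts Q \<and> p = [] then 1 else 0)"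
  and zero_path_algebra: "\<zero>\<^bsub>path_algebra Q\<^esub> = (\<lambda>w. 0)"
  and add_path_algebra: "x \<oplus>\<^bsub>path_algebra Q\<^esub> y = (\<lambda>w. x w + y w)"
  and smult_path_algebra: "c \<odot>\<^bsub>path_algebra Q\<^esub> x = (\<lambda>w. c * x w)"
  by (simp_all add: path_algebra_def)

text \<open>
  The reindexing behind associativity of the path product: cutting a path at \<open>j\<close> and \<open>i \<ge> j\<close>
  amounts to cutting it at \<open>j\<close> and cutting the remainder at \<open>k = i - j\<close>.
\<close>

lemma sum_triangle_shift:
  fixes g :: "nat \<Rightarrow> nat \<Rightarrow> 'b::comm_monoid_add"
  shows "(\<Sum>i\<le>n. \<Sum>j\<le>i. g i j) = (\<Sum>j\<le>n. \<Sum>k\<le>n - j. g (j + k) j)"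
proof -
  have "(\<Sum>i\<le>n. \<Sum>j\<le>i. g i j) = (\<Sum>(i, j)\<in>(SIGMA i:{..n}. {..i}). g i j)"
    by (simp add: sum.Sigma)
  also have "\<dots> = (\<Sum>(j, k)\<in>(SIGMA j:{..n}. {..n - j}). g (j + k) j)"
    by (rule sum.reindex_bij_witness[where i = "\<lambda>(j, k). (j + k, j)" and j = "\<lambda>(i, j). (j, i - j)"])
      auto
  also have "\<dots> = (\<Sum>j\<le>n. \<Sum>k\<le>n - j. g (j + k) j)"
    by (simp add: sum.Sigma)
  finally show ?thesis .
qed

context fin_digraph
begin

lemma awlast_append_walk: "awlast u (p @ q) = awlast (awlast u p) q"
  by (induction p arbitrary: u) auto

lemma paths_append_iff:
  "(u, p @ q) \<in> paths G \<longleftrightarrow> (u, p) \<in> paths G \<and> (awlast u p, q) \<in> paths G"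
  by (auto simp: paths_def)

lemma stationary_in_paths [simp]: "(u, []) \<in> paths G \<longleftrightarrow> u \<in> verts G"
  by (auto simp: paths_def awalk_Nil_iff)

lemma paths_Cons_iff:
  "(u, a # p) \<in> paths G \<longleftrightarrow> a \<in> arcs G \<and> u = tail G a \<and> (head G a, p) \<in> paths G"
  by (auto simp: paths_def awalk_Cons_iff)

lemma start_in_verts: "(u, p) \<in> paths G \<Longrightarrow> u \<in> verts G"
  by (auto simp: paths_def)

lemma path_mult_support:
  fixes x y :: "('a \<times> 'b list) \<Rightarrow> 'k::field"
  assumes "(x \<otimes>\<^bsub>path_algebra G\<^esub> y) (u, p) \<noteq> 0"
  shows "\<exists>q r. p = q @ r \<and> x (u, q) \<noteq> 0 \<and> y (awlast u q, r) \<noteq> 0"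
proof -
  obtain i where "x (u, take i p) * y (awlast u (take i p), drop i p) \<noteq> 0"
    using assms unfolding mult_path_algebra by (meson sum.not_neutral_contains_not_neutral)
  thus ?thesis by (metis append_take_drop_id mult_eq_0_iff)
qed

lemma path_mult_closed:
  fixes x y :: "('a \<times> 'b list) \<Rightarrow> 'k::field"
  assumes "x \<in> carrier (path_algebra G)" "y \<in> carrier (path_algebra G)"
  shows "x \<otimes>\<^bsub>path_algebra G\<^esub> y \<in> carrier (path_algebra G)"
proof -
  let ?xy = "x \<otimes>\<^bsub>path_algebra G\<^esub> y"
  note cut = path_mult_support[of x y]
  have "{w. ?xy w \<noteq> 0} \<subseteq> (\<lambda>((u, p), (v, q)). (u, p @ q)) ` ({w. x w \<noteq> 0} \<times> {w. y w \<noteq> 0})"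
    using cut by (force simp: image_iff)
  moreover have "{w. ?xy w \<noteq> 0} \<subseteq> paths G"
    using cut assms by (fastforce simp: carrier_path_algebra paths_append_iff)
  ultimately show ?thesis
    using assms unfolding carrier_path_algebra
    by (auto intro: finite_subset)
qed

lemma path_mult_assoc:
  fixes x y z :: "('a \<times> 'b list) \<Rightarrow> 'k::field"
  shows "(x \<otimes>\<^bsub>path_algebra G\<^esub> y) \<otimes>\<^bsub>path_algebra G\<^esub> z = x \<otimes>\<^bsub>path_algebra G\<^esub> (y \<otimes>\<^bsub>path_algebra G\<^esub> z)"
proof (rule ext, clarify)
  fix u p
  define g where "g = (\<lambda>i j. x (u, take j p) *
    (y (awlast u (take j p), drop j (take i p)) * z (awlast u (take i p), drop i p)))"
  have "((x \<otimes>\<^bsub>path_algebra G\<^esub> y) \<otimes>\<^bsub>path_algebra G\<^esub> z) (u, p) = (\<Sum>i\<le>length p. \<Sum>j\<le>i. g i j)"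
    unfolding mult_path_algebra g_def
    by (intro sum.cong refl) (auto simp: sum_distrib_right min_def mult.assoc intro!: sum.cong)
  also have "\<dots> = (\<Sum>j\<le>length p. \<Sum>k\<le>length p - j. g (j + k) j)"
    by (rule sum_triangle_shift)
  also have "\<dots> = (x \<otimes>\<^bsub>path_algebra G\<^esub> (y \<otimes>\<^bsub>path_algebra G\<^esub> z)) (u, p)"
    unfolding mult_path_algebra g_def
    by (intro sum.cong refl)
      (simp add: sum_distrib_left take_add awlast_append_walk drop_take add.commute)
  finally show "((x \<otimes>\<^bsub>path_algebra G\<^esub> y) \<otimes>\<^bsub>path_algebra G\<^esub> z) (u, p) =
    (x \<otimes>\<^bsub>path_algebra G\<^esub> (y \<otimes>\<^bsub>path_algebra G\<^esub> z)) (u, p)" .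
qed

text \<open>
  Scalar multiples are products with multiples of the unit, so every ideal is a linear subspace;
  for \<open>c = 1\<close> this is the left unit law.
\<close>

lemma smult_one_mult:
  fixes x :: "('a \<times> 'b list) \<Rightarrow> 'k::field"
  assumes "x \<in> carrier (path_algebra G)"
  shows "(c \<odot>\<^bsub>path_algebra G\<^esub> \<one>\<^bsub>path_algebra G\<^esub>) \<otimes>\<^bsub>path_algebra G\<^esub> x = c \<odot>\<^bsub>path_algebra G\<^esub> x"
proof (rule ext, clarify)
  fix u p
  have "((c \<odot>\<^bsub>path_algebra G\<^esub> \<one>\<^bsub>path_algebra G\<^esub>) \<otimes>\<^bsub>path_algebra G\<^esub> x) (u, p) =
    (\<Sum>i\<le>length p. if i = 0 then if u \<in> verts G then c * x (u, p) else 0 else 0)"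
    unfolding mult_path_algebra smult_path_algebra one_path_algebra
    by (intro sum.cong) auto
  also have "\<dots> = c * x (u, p)"
    using assms start_in_verts[of u p] by (auto simp: carrier_path_algebra)
  finally show "((c \<odot>\<^bsub>path_algebra G\<^esub> \<one>\<^bsub>path_algebra G\<^esub>) \<otimes>\<^bsub>path_algebra G\<^esub> x) (u, p) =
    (c \<odot>\<^bsub>path_algebra G\<^esub> x) (u, p)"
    by (simp add: smult_path_algebra)
qed

lemma path_mult_one:
  fixes x :: "('a \<times> 'b list) \<Rightarrow> 'k::field"
  assumes "x \<in> carrier (path_algebra G)"
  shows "x \<otimes>\<^bsub>path_algebra G\<^esub> \<one>\<^bsub>path_algebra G\<^esub> = x"
proof (rule ext, clarify)
  fix u p
  have "(x \<otimes>\<^bsub>path_algebra G\<^esub> \<one>\<^bsub>path_algebra G\<^esub>) (u, p) =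
    (\<Sum>i\<le>length p. if i = length p then if awlast u p \<in> verts G then x (u, p) else 0 else 0)"
    unfolding mult_path_algebra one_path_algebra
    by (intro sum.cong) auto
  also have "\<dots> = x (u, p)"
    using assms paths_append_iff[of u p "[]"] by (auto simp: carrier_path_algebra)
  finally show "(x \<otimes>\<^bsub>path_algebra G\<^esub> \<one>\<^bsub>path_algebra G\<^esub>) (u, p) = x (u, p)" .
qed

lemma one_in_path_algebra:
  "(\<one>\<^bsub>path_algebra G\<^esub> :: ('a \<times> 'b list) \<Rightarrow> 'k::field) \<in> carrier (path_algebra G)"
proof -
  have "{w. (\<one>\<^bsub>path_algebra G\<^esub> w :: 'k) \<noteq> 0} = (\<lambda>u. (u, [])) ` verts G"
    by (auto simp: one_path_algebra split: if_splits)
  thus ?thesis by (auto simp: carrier_path_algebra)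
qed

lemma smult_in_path_algebra:
  fixes x :: "('a \<times> 'b list) \<Rightarrow> 'k::field"
  assumes "x \<in> carrier (path_algebra G)"
  shows "c \<odot>\<^bsub>path_algebra G\<^esub> x \<in> carrier (path_algebra G)"
  using assms by (auto simp: carrier_path_algebra smult_path_algebra elim: rev_finite_subset)

lemma add_in_path_algebra:
  fixes x :: "('a \<times> 'b list) \<Rightarrow> 'k::field"
  assumes "x \<in> carrier (path_algebra G)" "y \<in> carrier (path_algebra G)"
  shows "x \<oplus>\<^bsub>path_algebra G\<^esub> y \<in> carrier (path_algebra G)"
proof -
  have "{w. x w + y w \<noteq> 0} \<subseteq> {w. x w \<noteq> 0} \<union> {w. y w \<noteq> 0}" by auto
  moreover have "finite ({w. x w \<noteq> 0} \<union> {w. y w \<noteq> 0})" "{w. x w \<noteq> 0} \<union> {w. y w \<noteq> 0} \<subseteq> paths G"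
    using assms by (auto simp: carrier_path_algebra)
  ultimately show ?thesis
    unfolding carrier_path_algebra add_path_algebra by (blast intro: finite_subset)
qed

lemma ring_path_algebra: "ring (path_algebra G :: ('k::field, ('a \<times> 'b list) \<Rightarrow> 'k) module)"
proof (rule ringI)
  show "abelian_group (path_algebra G :: ('k, ('a \<times> 'b list) \<Rightarrow> 'k) module)"
  proof (rule abelian_groupI)
    fix x :: "('a \<times> 'b list) \<Rightarrow> 'k" assume x: "x \<in> carrier (path_algebra G)"
    have "(-1) \<odot>\<^bsub>path_algebra G\<^esub> x \<oplus>\<^bsub>path_algebra G\<^esub> x = \<zero>\<^bsub>path_algebra G\<^esub>"
      by (auto simp: smult_path_algebra add_path_algebra zero_path_algebra)
    thus "\<exists>y\<in>carrier (path_algebra G). y \<oplus>\<^bsub>path_algebra G\<^esub> x = \<zero>\<^bsub>path_algebra G\<^esub>"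
      using smult_in_path_algebra[OF x] by blast
  next
    show "\<zero>\<^bsub>path_algebra G\<^esub> \<in> (carrier (path_algebra G) :: (('a \<times> 'b list) \<Rightarrow> 'k) set)"
      by (simp add: carrier_path_algebra zero_path_algebra)
  qed (simp_all add: add_in_path_algebra, simp_all add: add_path_algebra zero_path_algebra algebra_simps)
  show "monoid (path_algebra G :: ('k, ('a \<times> 'b list) \<Rightarrow> 'k) module)"
  proof (rule monoidI)
    fix x :: "('a \<times> 'b list) \<Rightarrow> 'k" assume x: "x \<in> carrier (path_algebra G)"
    show "\<one>\<^bsub>path_algebra G\<^esub> \<otimes>\<^bsub>path_algebra G\<^esub> x = x"
      using smult_one_mult[OF x, of 1] by (simp add: smult_path_algebra)
  qed (simp_all add: path_mult_closed one_in_path_algebra path_mult_assoc path_mult_one)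
qed (auto simp: fun_eq_iff mult_path_algebra add_path_algebra sum.distrib algebra_simps)

lemma path_elem_in_path_algebra:
  "w \<in> paths G \<Longrightarrow> (path_elem w :: _ \<Rightarrow> 'k::field) \<in> carrier (path_algebra G)"
  by (auto simp: carrier_path_algebra path_elem_def)

lemma path_elem_append:
  "(path_elem (u, p @ q) :: _ \<Rightarrow> 'k::field) =
    path_elem (u, p) \<otimes>\<^bsub>path_algebra G\<^esub> path_elem (awlast u p, q)"
proof (rule ext, clarify)
  fix u' r
  have "(path_elem (u, p) \<otimes>\<^bsub>path_algebra G\<^esub> path_elem (awlast u p, q)) (u', r) =
    (\<Sum>i\<le>length r. if i = length p then if (u', r) = (u, p @ q) then 1 else (0::'k) else 0)"
    unfolding mult_path_algebra path_elem_def
  proof (intro sum.cong refl)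
    fix i assume "i \<in> {..length r}"
    hence "take i r = p \<Longrightarrow> i = length p" by auto
    moreover have "take (length p) r = p \<and> drop (length p) r = q \<longleftrightarrow> r = p @ q"
      by (metis append_eq_conv_conj)
    ultimately show "(if (u', take i r) = (u, p) then 1 else 0) *
        (if (awlast u' (take i r), drop i r) = (awlast u p, q) then 1 else 0) =
      (if i = length p then if (u', r) = (u, p @ q) then 1 else (0::'k) else 0)"
      by (cases "i = length p") auto
  qed
  also have "\<dots> = path_elem (u, p @ q) (u', r)"
    by (auto simp: path_elem_def)
  finally show "(path_elem (u, p @ q) (u', r) :: 'k) =
    (path_elem (u, p) \<otimes>\<^bsub>path_algebra G\<^esub> path_elem (awlast u p, q)) (u', r)" by simp
qed

text \<open>
  Linear induction. The induction only adds multiples of paths from the support of \<open>x\<close>, so that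
  \<open>P\<close> can exploit information on that support.
\<close>

lemma path_algebra_support_induct:
  fixes x :: "('a \<times> 'b list) \<Rightarrow> 'k::field"
  assumes x: "x \<in> carrier (path_algebra G)"
    and zero: "P \<zero>\<^bsub>path_algebra G\<^esub>"
    and add: "\<And>c w y. \<lbrakk>x w \<noteq> 0; w \<in> paths G; y \<in> carrier (path_algebra G); P y\<rbrakk> \<Longrightarrow>
      P (c \<odot>\<^bsub>path_algebra G\<^esub> path_elem w \<oplus>\<^bsub>path_algebra G\<^esub> y)"
  shows "P x"
proof -
  have "P (\<lambda>w. if w \<in> F then x w else 0)" if "finite F" "F \<subseteq> {w. x w \<noteq> 0}" for F
    using that
  proof (induction F)
    case empty
    then show ?case using zero by (simp add: zero_path_algebra)
  next
    case (insert w F)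
    have "(\<lambda>v. if v \<in> F then x v else 0) \<in> carrier (path_algebra G)"
      using x insert by (auto simp: carrier_path_algebra)
    moreover have "w \<in> paths G" using x insert by (auto simp: carrier_path_algebra)
    ultimately have "P (x w \<odot>\<^bsub>path_algebra G\<^esub> path_elem w \<oplus>\<^bsub>path_algebra G\<^esub> (\<lambda>v. if v \<in> F then x v else 0))"
      using add insert by auto
    also have "x w \<odot>\<^bsub>path_algebra G\<^esub> path_elem w \<oplus>\<^bsub>path_algebra G\<^esub> (\<lambda>v. if v \<in> F then x v else 0) =
      (\<lambda>v. if v \<in> insert w F then x v else 0)"
      using insert by (auto simp: path_elem_def smult_path_algebra add_path_algebra)
    finally show ?case .
  qed
  from this[of "{w. x w \<noteq> 0}"] have "P (\<lambda>w. if w \<in> {w. x w \<noteq> 0} then x w else 0)"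
    using x by (simp add: carrier_path_algebra)
  moreover have "(\<lambda>w. if w \<in> {w. x w \<noteq> 0} then x w else 0) = x" by auto
  ultimately show ?thesis by simp
qed

text \<open>
  The functions supported on the paths that contain a generator form an ideal, because this set of
  paths is closed under prolongation on both sides. Conversely such a path is a product with a
  generator as one factor, so the generated ideal contains the span of these paths.
\<close>

lemma monomial_ideal:
  fixes x :: "('a \<times> 'b list) \<Rightarrow> 'k::field"
  assumes S: "S \<subseteq> paths G"
  shows "x \<in> Idl\<^bsub>path_algebra G\<^esub> (path_elem ` S) \<longleftrightarrow> x \<in> carrier (path_algebra G) \<and>
    (\<forall>u p. x (u, p) \<noteq> 0 \<longrightarrow> (\<exists>a q b. p = a @ q @ b \<and> (awlast u a, q) \<in> S))"
proof -
  let ?P = "path_algebra G :: ('k, ('a \<times> 'b list) \<Rightarrow> 'k) module"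
  let ?I = "Idl\<^bsub>?P\<^esub> (path_elem ` S)"
  interpret P: ring ?P by (rule ring_path_algebra)
  define J where "J u p \<longleftrightarrow> (\<exists>a q b. p = a @ q @ b \<and> (awlast u a, q) \<in> S)" for u p
  define M where "M = {x \<in> carrier ?P. \<forall>u p. x (u, p) \<noteq> 0 \<longrightarrow> J u p}"
  have sub: "path_elem ` S \<subseteq> carrier ?P"
    using S path_elem_in_path_algebra by blast
  interpret I: ideal ?I ?P by (rule P.genideal_ideal[OF sub])
  have Jl: "J u (p @ q)" if "J (awlast u p) q" for u p q
    using that unfolding J_def by (metis append.assoc awlast_append_walk)
  have Jr: "J u (p @ q)" if "J u p" for u p q
    using that unfolding J_def by fastforce
  have "ideal M ?P"
  proof (rule idealI)
    show "ring ?P" by (rule ring_path_algebra)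
    show "subgroup M (add_monoid ?P)"
    proof (rule P.add.subgroupI)
      show "M \<subseteq> carrier ?P" by (auto simp: M_def)
      have "\<zero>\<^bsub>?P\<^esub> \<in> M" by (simp add: M_def) (simp add: zero_path_algebra)
      thus "M \<noteq> {}" by auto
    next
      fix a assume a: "a \<in> M"
      hence ac: "a \<in> carrier ?P" by (simp add: M_def)
      have "(-1) \<odot>\<^bsub>?P\<^esub> a \<oplus>\<^bsub>?P\<^esub> a = \<zero>\<^bsub>?P\<^esub>"
        by (auto simp: smult_path_algebra add_path_algebra zero_path_algebra)
      hence "\<ominus>\<^bsub>?P\<^esub> a = (-1) \<odot>\<^bsub>?P\<^esub> a"
        using ac smult_in_path_algebra[OF ac] P.minus_equality by blast
      thus "\<ominus>\<^bsub>?P\<^esub> a \<in> M"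
        using a smult_in_path_algebra[OF ac] by (auto simp: M_def) (auto simp: smult_path_algebra)
    next
      fix a b assume ab: "a \<in> M" "b \<in> M"
      have "J u p" if "(a \<oplus>\<^bsub>?P\<^esub> b) (u, p) \<noteq> 0" for u p
      proof -
        from that have "a (u, p) \<noteq> 0 \<or> b (u, p) \<noteq> 0" by (auto simp: add_path_algebra)
        thus ?thesis using ab unfolding M_def by blast
      qed
      thus "a \<oplus>\<^bsub>?P\<^esub> b \<in> M" using ab by (simp add: M_def)
    qed
  next
    fix a y assume a: "a \<in> M" and y: "y \<in> carrier ?P"
    have "J u p" if nz: "(y \<otimes>\<^bsub>?P\<^esub> a) (u, p) \<noteq> 0" for u p
    proof -
      obtain q r where "p = q @ r" "a (awlast u q, r) \<noteq> 0" using path_mult_support[OF nz] by blast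
      thus ?thesis using a Jl[of u q r] by (simp add: M_def)
    qed
    thus "y \<otimes>\<^bsub>?P\<^esub> a \<in> M" using a y by (simp add: M_def)
  next
    fix a y assume a: "a \<in> M" and y: "y \<in> carrier ?P"
    have "J u p" if nz: "(a \<otimes>\<^bsub>?P\<^esub> y) (u, p) \<noteq> 0" for u p
    proof -
      obtain q r where "p = q @ r" "a (u, q) \<noteq> 0" using path_mult_support[OF nz] by blast
      thus ?thesis using a Jr[of u q r] by (simp add: M_def)
    qed
    thus "a \<otimes>\<^bsub>?P\<^esub> y \<in> M" using a y by (simp add: M_def)
  qed
  moreover have "path_elem ` S \<subseteq> M"
  proof
    fix y :: "('a \<times> 'b list) \<Rightarrow> 'k" assume y: "y \<in> path_elem ` S"
    hence "y \<in> carrier ?P" using sub by blast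
    moreover have "J u p" if "y (u, p) \<noteq> 0" for u p
      unfolding J_def
    proof (intro exI conjI)
      show "p = [] @ p @ []" by simp
      show "(awlast u [], p) \<in> S"
        using y that by (auto simp: path_elem_def split: if_splits)
    qed
    ultimately show "y \<in> M" by (simp add: M_def)
  qed
  ultimately have "?I \<subseteq> M" by (rule P.genideal_minimal)
  have elem: "path_elem w \<in> ?I" if w: "w \<in> paths G" "J (fst w) (snd w)" for w
  proof -
    obtain u p where w': "w = (u, p)" by fastforce
    then obtain a q b where p: "p = a @ q @ b" and q: "(awlast u a, q) \<in> S" using w by (auto simp: J_def)
    have "path_elem (awlast u a, q) \<in> ?I" using q P.genideal_self[OF sub] by blast
    moreover have "(path_elem (u, a) :: _ \<Rightarrow> 'k) \<in> carrier ?P" "(path_elem (awlast (awlast u a) q, b) :: _ \<Rightarrow> 'k) \<in> carrier ?P"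
      using w unfolding w' p by (auto intro!: path_elem_in_path_algebra simp: paths_append_iff)
    ultimately show ?thesis
      unfolding w' p path_elem_append by (intro I.I_l_closed I.I_r_closed)
  qed
  have "M \<subseteq> ?I"
  proof
    fix y assume y: "y \<in> M"
    hence yc: "y \<in> carrier ?P" by (simp add: M_def)
    show "y \<in> ?I"
    proof (rule path_algebra_support_induct[OF yc])
      fix c w z assume "y w \<noteq> 0" and w: "w \<in> paths G" and "z \<in> ?I"
      hence e: "path_elem w \<in> ?I" using y elem[OF w] by (cases w) (auto simp: M_def)
      have "(c \<odot>\<^bsub>?P\<^esub> \<one>\<^bsub>?P\<^esub>) \<otimes>\<^bsub>?P\<^esub> path_elem w \<in> ?I"
        by (intro I.I_l_closed e smult_in_path_algebra one_in_path_algebra)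
      moreover have "(path_elem w :: _ \<Rightarrow> 'k) \<in> carrier ?P"
        using w by (rule path_elem_in_path_algebra)
      ultimately show "c \<odot>\<^bsub>?P\<^esub> path_elem w \<oplus>\<^bsub>?P\<^esub> z \<in> ?I"
        using \<open>z \<in> ?I\<close> by (simp add: smult_one_mult)
    qed simp
  qed
  with \<open>?I \<subseteq> M\<close> have "?I = M" by (rule subset_antisym)
  hence "x \<in> ?I \<longleftrightarrow> x \<in> M" by (rule arg_cong)
  thus ?thesis unfolding M_def J_def mem_Collect_eq .
qed

end

section \<open>Coefficients of elements of a monomial algebra\<close>

text \<open>
  Relations of length at least two ensure that vertices and arrows remain basis elements of the
  quotient.
\<close>

locale monomial_algebra = fin_digraph Q
  for Q :: "('v, 'a) pre_digraph" +
  fixes I :: "(('v, 'a) path \<Rightarrow> 'k::field) set" and S :: "('v, 'a) path set"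
  assumes relations: "S \<subseteq> {w \<in> paths Q. 2 \<le> path_length w}"
    and ideal_eq: "I = Idl\<^bsub>path_algebra Q\<^esub> (path_elem ` S)"
begin

abbreviation P :: "('k, ('v, 'a) path \<Rightarrow> 'k) module" where "P \<equiv> path_algebra Q"
abbreviation A :: "('k, (('v, 'a) path \<Rightarrow> 'k) set) module" where "A \<equiv> bound_quiver_algebra Q I"
abbreviation B :: "('v, 'a) path set" where "B \<equiv> basis_paths Q I"

lemma relations_paths: "S \<subseteq> paths Q"
  using relations by auto

lemma basis_iff:
  "(u, p) \<in> B \<longleftrightarrow> (u, p) \<in> paths Q \<and> \<not> (\<exists>a q b. p = a @ q @ b \<and> (awlast u a, q) \<in> S)"
proof -
  have "(path_elem (u, p) :: _ \<Rightarrow> 'k) \<in> I \<longleftrightarrow> (\<exists>a q b. p = a @ q @ b \<and> (awlast u a, q) \<in> S)"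
    if "(u, p) \<in> paths Q"
  proof -
    have "(path_elem (u, p) :: _ \<Rightarrow> 'k) \<in> carrier P"
      using that by (rule path_elem_in_path_algebra)
    thus ?thesis
      unfolding ideal_eq monomial_ideal[OF relations_paths] by (simp add: path_elem_def)
  qed
  thus ?thesis unfolding basis_paths_def by blast
qed

lemma basis_paths_subset: "B \<subseteq> paths Q"
  by (auto simp: basis_paths_def)

lemma in_ideal_iff: "x \<in> I \<longleftrightarrow> x \<in> carrier P \<and> (\<forall>w. x w \<noteq> 0 \<longrightarrow> w \<notin> B)"
proof -
  have "x \<in> I \<longleftrightarrow> x \<in> carrier P \<and>
    (\<forall>u p. x (u, p) \<noteq> 0 \<longrightarrow> (\<exists>a q b. p = a @ q @ b \<and> (awlast u a, q) \<in> S))"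
    unfolding ideal_eq by (rule monomial_ideal[OF relations_paths])
  also have "\<dots> \<longleftrightarrow> x \<in> carrier P \<and> (\<forall>u p. x (u, p) \<noteq> 0 \<longrightarrow> (u, p) \<notin> B)"
    unfolding basis_iff carrier_path_algebra by blast
  finally show ?thesis by simp
qed

text \<open>
  Subpaths of basis paths are basis paths. This is why the product of two elements can be computed
  from their coefficients on basis paths alone.
\<close>

lemma basis_append:
  assumes "(u, p @ q) \<in> B"
  shows "(u, p) \<in> B" "(awlast u p, q) \<in> B"
proof -
  have in_paths: "(u, p) \<in> paths Q" "(awlast u p, q) \<in> paths Q"
    using assms unfolding basis_iff paths_append_iff by auto
  have no: "\<not> (p @ q = a @ s @ b \<and> (awlast u a, s) \<in> S)" for a s b
    using assms unfolding basis_iff by blast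
  show "(u, p) \<in> B"
    unfolding basis_iff using in_paths no by (metis append.assoc)
  show "(awlast u p, q) \<in> B"
    unfolding basis_iff using in_paths no by (metis append.assoc awlast_append_walk)
qed

lemma short_paths_in_basis:
  assumes "(u, p) \<in> paths Q" "length p \<le> 1"
  shows "(u, p) \<in> B"
proof -
  have "length q \<le> 1" if "p = a @ q @ b" for a q b using assms that by simp
  moreover have "2 \<le> length q" if "(v, q) \<in> S" for v q using relations that by auto
  ultimately show ?thesis unfolding basis_iff using assms by fastforce
qed

sublocale P: ring P by (rule ring_path_algebra)

sublocale I: ideal I P
  unfolding ideal_eq
  by (rule P.genideal_ideal) (use relations_paths path_elem_in_path_algebra in blast)

definition coset :: "(('v, 'a) path \<Rightarrow> 'k) \<Rightarrow> (('v, 'a) path \<Rightarrow> 'k) set" where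
  "coset x = I +>\<^bsub>P\<^esub> x"

text \<open>
  Any representative may be chosen in the definition, since the elements of \<open>I\<close> vanish on basis
  paths (\<open>coef_coset\<close>).
\<close>

definition coef :: "(('v, 'a) path \<Rightarrow> 'k) set \<Rightarrow> ('v, 'a) path \<Rightarrow> 'k" where
  "coef X w = (if w \<in> B then (SOME x. x \<in> X) w else 0)"

lemma carrier_A: "X \<in> carrier A \<longleftrightarrow> (\<exists>x \<in> carrier P. X = coset x)"
  by (auto simp: bound_quiver_algebra_def quotient_algebra_def ring.defs module.defs FactRing_def
      A_RCOSETS_def' coset_def)

lemma coset_carrier [simp, intro]: "x \<in> carrier P \<Longrightarrow> coset x \<in> carrier A"
  by (auto simp: carrier_A)

lemma coset_mult: "\<lbrakk>x \<in> carrier P; y \<in> carrier P\<rbrakk> \<Longrightarrow> coset x \<otimes>\<^bsub>A\<^esub> coset y = coset (x \<otimes>\<^bsub>P\<^esub> y)"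
  by (simp add: bound_quiver_algebra_def quotient_algebra_def ring.defs module.defs FactRing_def
      coset_def I.rcoset_mult_add)

lemma coset_add: "\<lbrakk>x \<in> carrier P; y \<in> carrier P\<rbrakk> \<Longrightarrow> coset x \<oplus>\<^bsub>A\<^esub> coset y = coset (x \<oplus>\<^bsub>P\<^esub> y)"
  by (simp add: bound_quiver_algebra_def quotient_algebra_def ring.defs module.defs FactRing_def
      coset_def I.a_rcos_sum)

lemma coset_one: "\<one>\<^bsub>A\<^esub> = coset \<one>\<^bsub>P\<^esub>"
  by (simp add: bound_quiver_algebra_def quotient_algebra_def ring.defs module.defs FactRing_def
      coset_def)

lemma coset_zero: "\<zero>\<^bsub>A\<^esub> = coset \<zero>\<^bsub>P\<^esub>"
  by (simp add: bound_quiver_algebra_def quotient_algebra_def ring.defs module.defs FactRing_def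
      coset_def P.a_rcos_zero I.ideal_axioms)

lemma smult_closed_P: "x \<in> carrier P \<Longrightarrow> c \<odot>\<^bsub>P\<^esub> x \<in> carrier P"
  by (rule smult_in_path_algebra)

lemma smult_in_ideal: "h \<in> I \<Longrightarrow> c \<odot>\<^bsub>P\<^esub> h \<in> I"
  using smult_closed_P[of h c] by (auto simp: in_ideal_iff) (simp add: smult_path_algebra)

lemma coset_smult:
  assumes x: "x \<in> carrier P"
  shows "c \<odot>\<^bsub>A\<^esub> coset x = coset (c \<odot>\<^bsub>P\<^esub> x)"
proof -
  have distr: "c \<odot>\<^bsub>P\<^esub> (h \<oplus>\<^bsub>P\<^esub> x) = c \<odot>\<^bsub>P\<^esub> h \<oplus>\<^bsub>P\<^esub> c \<odot>\<^bsub>P\<^esub> x" for h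
    by (simp add: smult_path_algebra add_path_algebra distrib_left)
  have "c \<odot>\<^bsub>A\<^esub> coset x = I <+>\<^bsub>P\<^esub> ((\<lambda>x. c \<odot>\<^bsub>P\<^esub> x) ` coset x)"
    by (simp add: bound_quiver_algebra_def quotient_algebra_def ring.defs module.defs)
  also have "\<dots> = coset (c \<odot>\<^bsub>P\<^esub> x)"
  proof
    show "I <+>\<^bsub>P\<^esub> ((\<lambda>x. c \<odot>\<^bsub>P\<^esub> x) ` coset x) \<subseteq> coset (c \<odot>\<^bsub>P\<^esub> x)"
    proof
      fix y assume "y \<in> I <+>\<^bsub>P\<^esub> ((\<lambda>x. c \<odot>\<^bsub>P\<^esub> x) ` coset x)"
      then obtain g h where gh: "g \<in> I" "h \<in> I" "y = g \<oplus>\<^bsub>P\<^esub> (c \<odot>\<^bsub>P\<^esub> (h \<oplus>\<^bsub>P\<^esub> x))"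
        unfolding set_add_def' coset_def a_r_coset_def' by blast
      hence "y = (g \<oplus>\<^bsub>P\<^esub> c \<odot>\<^bsub>P\<^esub> h) \<oplus>\<^bsub>P\<^esub> c \<odot>\<^bsub>P\<^esub> x"
        by (simp add: distr) (simp add: add_path_algebra add.assoc)
      moreover have "g \<oplus>\<^bsub>P\<^esub> c \<odot>\<^bsub>P\<^esub> h \<in> I" using gh smult_in_ideal by simp
      ultimately show "y \<in> coset (c \<odot>\<^bsub>P\<^esub> x)" unfolding coset_def a_r_coset_def' by blast
    qed
    show "coset (c \<odot>\<^bsub>P\<^esub> x) \<subseteq> I <+>\<^bsub>P\<^esub> ((\<lambda>x. c \<odot>\<^bsub>P\<^esub> x) ` coset x)"
    proof
      fix y assume "y \<in> coset (c \<odot>\<^bsub>P\<^esub> x)"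
      then obtain h where "h \<in> I" "y = h \<oplus>\<^bsub>P\<^esub> (c \<odot>\<^bsub>P\<^esub> x)"
        unfolding coset_def a_r_coset_def' by blast
      moreover have "x \<in> coset x"
        using x P.l_zero[OF x] I.zero_closed unfolding coset_def a_r_coset_def' by force
      ultimately show "y \<in> I <+>\<^bsub>P\<^esub> ((\<lambda>x. c \<odot>\<^bsub>P\<^esub> x) ` coset x)"
        unfolding set_add_def' by blast
    qed
  qed
  finally show ?thesis .
qed

lemma coef_coset:
  assumes "x \<in> carrier P"
  shows "coef (coset x) w = (if w \<in> B then x w else 0)"
proof -
  have "x \<in> coset x"
    using assms P.l_zero[OF assms] I.zero_closed unfolding coset_def a_r_coset_def' by force
  hence "(SOME y. y \<in> coset x) \<in> coset x" by (rule someI[of "\<lambda>y. y \<in> coset x"])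
  then obtain h where "h \<in> I" "(SOME y. y \<in> coset x) = h \<oplus>\<^bsub>P\<^esub> x"
    unfolding coset_def a_r_coset_def' by blast
  thus ?thesis by (cases w) (auto simp: coef_def in_ideal_iff add_path_algebra)
qed

lemma coset_eq_iff:
  assumes x: "x \<in> carrier P" and y: "y \<in> carrier P"
  shows "coset x = coset y \<longleftrightarrow> (\<forall>w\<in>B. x w = y w)"
proof -
  have neg: "\<ominus>\<^bsub>P\<^esub> y = (-1) \<odot>\<^bsub>P\<^esub> y"
  proof (rule P.minus_equality)
    show "(-1) \<odot>\<^bsub>P\<^esub> y \<oplus>\<^bsub>P\<^esub> y = \<zero>\<^bsub>P\<^esub>"
      by (auto simp: smult_path_algebra add_path_algebra zero_path_algebra)
  qed (use y smult_closed_P in auto)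
  have "coset x = coset y \<longleftrightarrow> x \<ominus>\<^bsub>P\<^esub> y \<in> I"
    unfolding coset_def using P.quotient_eq_iff_same_a_r_cos[OF I.ideal_axioms x y] by simp
  also have "\<dots> \<longleftrightarrow> (\<forall>w. (x \<ominus>\<^bsub>P\<^esub> y) w \<noteq> 0 \<longrightarrow> w \<notin> B)"
    using P.minus_closed[OF x y] unfolding in_ideal_iff by blast
  also have "\<dots> \<longleftrightarrow> (\<forall>w\<in>B. x w = y w)"
    unfolding a_minus_def neg by (auto simp: smult_path_algebra add_path_algebra)
  finally show ?thesis .
qed

lemma A_eqI:
  assumes "X \<in> carrier A" "Y \<in> carrier A" "\<And>w. w \<in> B \<Longrightarrow> coef X w = coef Y w"
  shows "X = Y"
proof -
  obtain x y where "x \<in> carrier P" "X = coset x" "y \<in> carrier P" "Y = coset y"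
    using assms by (auto simp: carrier_A)
  thus ?thesis using assms(3) by (simp add: coset_eq_iff coef_coset)
qed

lemma coef_outside: "w \<notin> B \<Longrightarrow> coef X w = 0"
  by (simp add: coef_def)

lemma coef_basis: "coef X w \<noteq> 0 \<Longrightarrow> w \<in> B"
  by (auto simp: coef_def split: if_splits)

lemma coef_finite:
  assumes "X \<in> carrier A"
  shows "finite {w. coef X w \<noteq> 0}"
proof -
  obtain x where x: "x \<in> carrier P" "X = coset x"
    using assms by (auto simp: carrier_A)
  have "{w. coef X w \<noteq> 0} \<subseteq> {w. x w \<noteq> 0}" using x by (auto simp: coef_coset)
  thus ?thesis using x by (auto simp: carrier_path_algebra intro: finite_subset)
qed

text \<open>
  Together with \<open>A_eqI\<close> this identifies \<open>A\<close> with the finitely supported functions on the basis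
  paths.
\<close>

lemma element_with_coefs:
  assumes "finite {w. x w \<noteq> 0}" "{w. x w \<noteq> 0} \<subseteq> B"
  shows "coset x \<in> carrier A" "coef (coset x) = x"
proof -
  have x: "x \<in> carrier P"
    using assms basis_paths_subset by (auto simp: carrier_path_algebra)
  thus "coset x \<in> carrier A" by blast
  show "coef (coset x) = x"
    using assms by (auto simp: fun_eq_iff coef_coset[OF x])
qed

lemma coef_in_carrier: "X \<in> carrier A \<Longrightarrow> coef X \<in> carrier P"
  using coef_finite basis_paths_subset coef_basis by (auto simp: carrier_path_algebra)

lemma coset_coef: "X \<in> carrier A \<Longrightarrow> coset (coef X) = X"
  by (rule A_eqI) (auto simp: coef_in_carrier coef_coset)

lemma add_closed [simp, intro]:
  assumes "X \<in> carrier A" "Y \<in> carrier A"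
  shows "X \<oplus>\<^bsub>A\<^esub> Y \<in> carrier A"
  using assms by (auto simp: carrier_A coset_add intro!: P.a_closed)

lemma mult_closed [simp, intro]:
  assumes "X \<in> carrier A" "Y \<in> carrier A"
  shows "X \<otimes>\<^bsub>A\<^esub> Y \<in> carrier A"
  using assms by (auto simp: carrier_A coset_mult intro!: P.m_closed)

lemma smult_closed [simp, intro]:
  assumes "X \<in> carrier A"
  shows "c \<odot>\<^bsub>A\<^esub> X \<in> carrier A"
  using assms by (auto simp: carrier_A coset_smult intro!: smult_closed_P)

lemma one_closed [simp, intro]: "\<one>\<^bsub>A\<^esub> \<in> carrier A"
  by (simp add: coset_one)

lemma zero_closed [simp, intro]: "\<zero>\<^bsub>A\<^esub> \<in> carrier A"
  by (simp add: coset_zero)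

lemma coef_add:
  assumes "X \<in> carrier A" "Y \<in> carrier A"
  shows "coef (X \<oplus>\<^bsub>A\<^esub> Y) w = coef X w + coef Y w"
proof -
  obtain x y where "x \<in> carrier P" "X = coset x" "y \<in> carrier P" "Y = coset y"
    using assms by (auto simp: carrier_A)
  thus ?thesis by (simp add: coset_add coef_coset) (simp add: add_path_algebra)
qed

lemma coef_smult:
  assumes "X \<in> carrier A"
  shows "coef (c \<odot>\<^bsub>A\<^esub> X) w = c * coef X w"
proof -
  obtain x where "x \<in> carrier P" "X = coset x"
    using assms by (auto simp: carrier_A)
  thus ?thesis by (simp add: coset_smult coef_coset smult_closed_P) (simp add: smult_path_algebra)
qed

lemma coef_zero: "coef \<zero>\<^bsub>A\<^esub> w = 0"
  by (simp add: coset_zero coef_coset) (simp add: zero_path_algebra)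

lemma coef_one: "coef \<one>\<^bsub>A\<^esub> (u, p) = (if u \<in> verts Q \<and> p = [] then 1 else 0)"
proof -
  have "(u, []) \<in> B" if "u \<in> verts Q" using that by (intro short_paths_in_basis) auto
  thus ?thesis by (auto simp: coset_one coef_coset) (auto simp: one_path_algebra)
qed

lemma coef_mult:
  assumes "X \<in> carrier A" "Y \<in> carrier A"
  shows "coef (X \<otimes>\<^bsub>A\<^esub> Y) (u, p) = (if (u, p) \<in> B then
    (\<Sum>i\<le>length p. coef X (u, take i p) * coef Y (awlast u (take i p), drop i p)) else 0)"
proof -
  obtain x y where xy: "x \<in> carrier P" "X = coset x" "y \<in> carrier P" "Y = coset y"
    using assms by (auto simp: carrier_A)
  have parts: "(u, take i p) \<in> B \<and> (awlast u (take i p), drop i p) \<in> B" if "(u, p) \<in> B" for i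
    using that basis_append[of u "take i p" "drop i p"] by simp
  show ?thesis
    using xy parts by (simp add: coset_mult coef_coset mult_path_algebra)
qed

lemma A_abelian_group: "abelian_group A"
proof (rule abelian_groupI)
  fix X assume X: "X \<in> carrier A"
  have "(-1) \<odot>\<^bsub>A\<^esub> X \<oplus>\<^bsub>A\<^esub> X = \<zero>\<^bsub>A\<^esub>"
    by (rule A_eqI) (use X in \<open>auto simp: coef_add coef_smult coef_zero\<close>)
  thus "\<exists>Y\<in>carrier A. Y \<oplus>\<^bsub>A\<^esub> X = \<zero>\<^bsub>A\<^esub>" using X by blast
next
  fix X assume X: "X \<in> carrier A"
  show "\<zero>\<^bsub>A\<^esub> \<oplus>\<^bsub>A\<^esub> X = X"
    by (rule A_eqI) (use X in \<open>auto simp: coef_add coef_zero\<close>)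
next
  fix X Y Z assume "X \<in> carrier A" "Y \<in> carrier A" "Z \<in> carrier A"
  thus "X \<oplus>\<^bsub>A\<^esub> Y \<oplus>\<^bsub>A\<^esub> Z = X \<oplus>\<^bsub>A\<^esub> (Y \<oplus>\<^bsub>A\<^esub> Z)"
    by (intro A_eqI) (simp_all add: coef_add add.assoc add_closed)
next
  fix X Y assume "X \<in> carrier A" "Y \<in> carrier A"
  thus "X \<oplus>\<^bsub>A\<^esub> Y = Y \<oplus>\<^bsub>A\<^esub> X"
    by (intro A_eqI) (simp_all add: coef_add add.commute add_closed)
qed auto

sublocale A: abelian_group A by (rule A_abelian_group)

lemma coef_minus:
  assumes "X \<in> carrier A" "Y \<in> carrier A"
  shows "coef (X \<ominus>\<^bsub>A\<^esub> Y) w = coef X w - coef Y w"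
proof -
  have "coef X w = coef ((X \<ominus>\<^bsub>A\<^esub> Y) \<oplus>\<^bsub>A\<^esub> Y) w"
    using assms by (simp add: a_minus_def A.a_assoc A.l_neg)
  thus ?thesis using assms by (simp add: coef_add)
qed

lemma coef_finsum:
  assumes "finite F" "\<And>i. i \<in> F \<Longrightarrow> Y i \<in> carrier A"
  shows "coef (\<Oplus>\<^bsub>A\<^esub>i\<in>F. Y i) w = (\<Sum>i\<in>F. coef (Y i) w)"
  using assms
proof (induction F)
  case empty
  thus ?case by (simp add: coef_zero)
next
  case (insert i F)
  have "(\<Oplus>\<^bsub>A\<^esub>j\<in>insert i F. Y j) = Y i \<oplus>\<^bsub>A\<^esub> (\<Oplus>\<^bsub>A\<^esub>j\<in>F. Y j)"
    using insert by (intro A.finsum_insert) auto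
  thus ?case using insert by (simp add: coef_add A.finsum_closed)
qed

section \<open>The associated graded map\<close>

text \<open>
  The sum of the homogeneous components whose degrees lie in \<open>N\<close>.
\<close>

definition part :: "nat set \<Rightarrow> (('v, 'a) path \<Rightarrow> 'k) set \<Rightarrow> (('v, 'a) path \<Rightarrow> 'k) set" where
  "part N X = coset (\<lambda>w. if path_length w \<in> N then coef X w else 0)"

lemma
  assumes "X \<in> carrier A"
  shows part_closed [simp, intro]: "part N X \<in> carrier A"
    and coef_part: "coef (part N X) w = (if path_length w \<in> N then coef X w else 0)"
proof -
  let ?x = "\<lambda>w. if path_length w \<in> N then coef X w else 0"
  have "{w. ?x w \<noteq> 0} \<subseteq> {w. coef X w \<noteq> 0}" by auto
  hence "finite {w. ?x w \<noteq> 0}" "{w. ?x w \<noteq> 0} \<subseteq> B"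
    using coef_finite[OF assms] coef_basis by (auto intro: finite_subset)
  thus "part N X \<in> carrier A" "coef (part N X) w = ?x w"
    unfolding part_def using element_with_coefs[of ?x] by auto
qed

lemma part_split: "X \<in> carrier A \<Longrightarrow> part N X \<oplus>\<^bsub>A\<^esub> part (- N) X = X"
  by (rule A_eqI) (auto simp: coef_add coef_part)

lemma graded_span_iff:
  "X \<in> graded_span Q I N \<longleftrightarrow> X \<in> carrier A \<and> (\<forall>w. coef X w \<noteq> 0 \<longrightarrow> path_length w \<in> N)"
proof
  assume "X \<in> graded_span Q I N"
  then obtain x where "X = coset x" "x \<in> carrier P" "\<forall>w. x w \<noteq> 0 \<longrightarrow> w \<in> B \<and> path_length w \<in> N"
    unfolding graded_span_def coset_def by blast
  thus "X \<in> carrier A \<and> (\<forall>w. coef X w \<noteq> 0 \<longrightarrow> path_length w \<in> N)"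
    by (simp add: coef_coset)
next
  assume X: "X \<in> carrier A \<and> (\<forall>w. coef X w \<noteq> 0 \<longrightarrow> path_length w \<in> N)"
  hence "X = coset (coef X)" "coef X \<in> carrier P"
    by (simp_all add: coset_coef coef_in_carrier)
  thus "X \<in> graded_span Q I N"
    unfolding graded_span_def coset_def using X coef_basis by blast
qed

lemma degree_component_eq:
  assumes X: "X \<in> carrier A"
  shows "degree_component Q I n X = part {n} X"
  unfolding degree_component_def
proof (rule the_equality)
  show "part {n} X \<in> graded_span Q I {n} \<and> X \<ominus>\<^bsub>A\<^esub> part {n} X \<in> graded_span Q I (- {n})"
    using X by (auto simp: graded_span_iff coef_part coef_minus split: if_splits)
next
  fix Y assume Y: "Y \<in> graded_span Q I {n} \<and> X \<ominus>\<^bsub>A\<^esub> Y \<in> graded_span Q I (- {n})"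
  hence Yc: "Y \<in> carrier A" by (simp add: graded_span_iff)
  show "Y = part {n} X"
  proof (rule A_eqI[OF Yc part_closed[OF X]])
    fix w
    have "coef Y w \<noteq> 0 \<longrightarrow> path_length w = n" "coef X w - coef Y w \<noteq> 0 \<longrightarrow> path_length w \<noteq> n"
      using Y unfolding graded_span_iff coef_minus[OF X Yc, symmetric] by blast+
    thus "coef Y w = coef (part {n} X) w"
      using X by (auto simp: coef_part)
  qed
qed

text \<open>
  Each homogeneous component of \<open>gr f X\<close> comes from the component of \<open>X\<close> in the same degree; this
  replaces the sum over all degrees in the definition of \<open>gr\<close> by a single term.
\<close>

lemma
  assumes X: "X \<in> carrier A" and f: "f \<in> carrier A \<rightarrow> carrier A" and f0: "f \<zero>\<^bsub>A\<^esub> = \<zero>\<^bsub>A\<^esub>"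
  shows gr_closed: "gr Q I f X \<in> carrier A"
    and coef_gr: "coef (gr Q I f X) w = coef (f (part {path_length w} X)) w"
proof -
  define N where "N = {n. degree_component Q I n X \<noteq> \<zero>\<^bsub>A\<^esub>}"
  have f_part: "f (part {n} X) \<in> carrier A" for n using f X by auto
  have zero: "part {n} X = \<zero>\<^bsub>A\<^esub>" if "n \<notin> path_length ` {w. coef X w \<noteq> 0}" for n
    using that X by (intro A_eqI) (auto simp: coef_part coef_zero)
  have "N \<subseteq> path_length ` {w. coef X w \<noteq> 0}"
    using zero X by (auto simp: N_def degree_component_eq)
  hence fin: "finite N" using coef_finite[OF X] finite_subset by blast
  have gr: "gr Q I f X = (\<Oplus>\<^bsub>A\<^esub>n\<in>N. degree_component Q I n (f (degree_component Q I n X)))"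
    using X by (simp add: gr_def Let_def N_def)
  have closed: "degree_component Q I n (f (degree_component Q I n X)) \<in> carrier A" for n
    using X f_part by (simp add: degree_component_eq)
  show "gr Q I f X \<in> carrier A"
    unfolding gr by (rule A.finsum_closed) (use closed in auto)
  have "coef (gr Q I f X) w =
    (\<Sum>n\<in>N. coef (degree_component Q I n (f (degree_component Q I n X))) w)"
    unfolding gr by (rule coef_finsum[OF fin closed])
  also have "\<dots> = (\<Sum>n\<in>N. if n = path_length w then coef (f (part {n} X)) w else 0)"
    using X f_part by (intro sum.cong) (auto simp: degree_component_eq coef_part)
  also have "\<dots> = coef (f (part {path_length w} X)) w"
    using fin f0 X by (auto simp: N_def degree_component_eq coef_zero)
  finally show "coef (gr Q I f X) w = coef (f (part {path_length w} X)) w" .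
qed

definition endomorphism ::
  "((('v, 'a) path \<Rightarrow> 'k) set \<Rightarrow> (('v, 'a) path \<Rightarrow> 'k) set) \<Rightarrow> bool" where
  "endomorphism f \<longleftrightarrow> f \<in> ring_hom A A \<and> (\<forall>c. \<forall>X \<in> carrier A. f (c \<odot>\<^bsub>A\<^esub> X) = c \<odot>\<^bsub>A\<^esub> f X)"

lemma
  assumes "endomorphism f"
  shows endo_closed: "X \<in> carrier A \<Longrightarrow> f X \<in> carrier A"
    and endo_add: "\<lbrakk>X \<in> carrier A; Y \<in> carrier A\<rbrakk> \<Longrightarrow> f (X \<oplus>\<^bsub>A\<^esub> Y) = f X \<oplus>\<^bsub>A\<^esub> f Y"
    and endo_mult: "\<lbrakk>X \<in> carrier A; Y \<in> carrier A\<rbrakk> \<Longrightarrow> f (X \<otimes>\<^bsub>A\<^esub> Y) = f X \<otimes>\<^bsub>A\<^esub> f Y"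
    and endo_one: "f \<one>\<^bsub>A\<^esub> = \<one>\<^bsub>A\<^esub>"
    and endo_smult: "X \<in> carrier A \<Longrightarrow> f (c \<odot>\<^bsub>A\<^esub> X) = c \<odot>\<^bsub>A\<^esub> f X"
  using assms by (auto simp: endomorphism_def ring_hom_def)

lemma endo_zero:
  assumes "endomorphism f"
  shows "f \<zero>\<^bsub>A\<^esub> = \<zero>\<^bsub>A\<^esub>"
proof -
  have "0 \<odot>\<^bsub>A\<^esub> X = \<zero>\<^bsub>A\<^esub>" if "X \<in> carrier A" for X
    using that by (intro A_eqI) (auto simp: coef_smult coef_zero)
  thus ?thesis using endo_smult[OF assms, of "\<zero>\<^bsub>A\<^esub>" 0] endo_closed[OF assms] by simp
qed

lemma endo_finsum:
  assumes f: "endomorphism f" and "finite F" "\<And>i. i \<in> F \<Longrightarrow> Y i \<in> carrier A"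
  shows "f (\<Oplus>\<^bsub>A\<^esub>i\<in>F. Y i) = (\<Oplus>\<^bsub>A\<^esub>i\<in>F. f (Y i))"
  using assms(2-)
proof (induction F)
  case empty
  thus ?case by (simp add: endo_zero[OF f])
next
  case (insert i F)
  have "(\<Oplus>\<^bsub>A\<^esub>j\<in>insert i F. Y j) = Y i \<oplus>\<^bsub>A\<^esub> (\<Oplus>\<^bsub>A\<^esub>j\<in>F. Y j)"
    "(\<Oplus>\<^bsub>A\<^esub>j\<in>insert i F. f (Y j)) = f (Y i) \<oplus>\<^bsub>A\<^esub> (\<Oplus>\<^bsub>A\<^esub>j\<in>F. f (Y j))"
    using insert endo_closed[OF f] by (auto intro!: A.finsum_insert)
  thus ?case using insert by (simp add: endo_add[OF f] A.finsum_closed)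
qed

lemma
  assumes "endomorphism f" "X \<in> carrier A"
  shows endo_coef_gr: "coef (gr Q I f X) w = coef (f (part {path_length w} X)) w"
    and endo_gr_closed: "gr Q I f X \<in> carrier A"
  using coef_gr[of X f w] gr_closed[of X f] assms endo_closed[OF assms(1)] endo_zero[OF assms(1)]
  by auto

text \<open>
  Every degree occurring in \<open>f X\<close> is \<open>r\<close>-above a degree occurring in \<open>X\<close>. With \<open>r\<close> one of \<open>\<le>\<close>,
  \<open>\<ge>\<close> and \<open>=\<close> this says that \<open>f\<close> only raises degrees, only lowers degrees, or is graded.
\<close>

definition triangular ::
  "(nat \<Rightarrow> nat \<Rightarrow> bool) \<Rightarrow> ((('v, 'a) path \<Rightarrow> 'k) set \<Rightarrow> (('v, 'a) path \<Rightarrow> 'k) set) \<Rightarrow> bool" where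
  "triangular r f \<longleftrightarrow> (\<forall>X \<in> carrier A. \<forall>v. coef (f X) v \<noteq> 0 \<longrightarrow>
    (\<exists>w. coef X w \<noteq> 0 \<and> r (path_length w) (path_length v)))"

lemma path_class_coset: "path_class Q I w = coset (path_elem w)"
  by (simp add: path_class_def coset_def)

lemma
  assumes "w \<in> B"
  shows path_class_closed: "path_class Q I w \<in> carrier A"
    and coef_path_class: "coef (path_class Q I w) v = (if v = w then 1 else 0)"
proof -
  have pe: "(path_elem w :: _ \<Rightarrow> 'k) \<in> carrier P"
    using assms basis_paths_subset path_elem_in_path_algebra by blast
  thus "path_class Q I w \<in> carrier A" by (simp add: path_class_coset)
  show "coef (path_class Q I w) v = (if v = w then 1 else 0)"
    unfolding path_class_coset coef_coset[OF pe] using assms by (simp add: path_elem_def)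
qed

text \<open>
  By linearity the condition needs to be checked on basis paths only.
\<close>

lemma triangularI:
  assumes f: "endomorphism f"
    and basis: "\<And>w v. \<lbrakk>w \<in> B; coef (f (path_class Q I w)) v \<noteq> 0\<rbrakk> \<Longrightarrow> r (path_length w) (path_length v)"
  shows "triangular r f"
  unfolding triangular_def
proof (intro ballI allI)
  fix X v assume X: "X \<in> carrier A"
  have "coef (f (coset (coef X))) v \<noteq> 0 \<longrightarrow>
    (\<exists>w. coef X w \<noteq> 0 \<and> r (path_length w) (path_length v))"
  proof (rule path_algebra_support_induct[OF coef_in_carrier[OF X],
        where P = "\<lambda>x. coef (f (coset x)) v \<noteq> 0 \<longrightarrow>
          (\<exists>w. coef X w \<noteq> 0 \<and> r (path_length w) (path_length v))"])
    show "coef (f (coset \<zero>\<^bsub>P\<^esub>)) v \<noteq> 0 \<longrightarrow>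
      (\<exists>w. coef X w \<noteq> 0 \<and> r (path_length w) (path_length v))"
      by (simp add: coset_zero[symmetric] endo_zero[OF f] coef_zero)
  next
    fix c w y
    assume w: "coef X w \<noteq> 0" and y: "y \<in> carrier P"
      and IH: "coef (f (coset y)) v \<noteq> 0 \<longrightarrow> (\<exists>w. coef X w \<noteq> 0 \<and> r (path_length w) (path_length v))"
    have wB: "w \<in> B" using w by (rule coef_basis)
    have pe: "path_elem w \<in> carrier P"
      using wB basis_paths_subset path_elem_in_path_algebra by blast
    have "coef (f (coset (c \<odot>\<^bsub>P\<^esub> path_elem w \<oplus>\<^bsub>P\<^esub> y))) v =
      c * coef (f (path_class Q I w)) v + coef (f (coset y)) v"
      using y pe endo_closed[OF f]
      by (simp add: coset_add[symmetric] coset_smult[symmetric] smult_closed_P path_class_coset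
          endo_add[OF f] endo_smult[OF f] coef_add coef_smult smult_closed)
    thus "coef (f (coset (c \<odot>\<^bsub>P\<^esub> path_elem w \<oplus>\<^bsub>P\<^esub> y))) v \<noteq> 0 \<longrightarrow>
      (\<exists>w. coef X w \<noteq> 0 \<and> r (path_length w) (path_length v))"
      using IH w basis[OF wB, of v] by (metis add_cancel_left_left mult_zero_right)
  qed
  thus "coef (f X) v \<noteq> 0 \<longrightarrow> (\<exists>w. coef X w \<noteq> 0 \<and> r (path_length w) (path_length v))"
    by (simp add: coset_coef[OF X])
qed

lemma triangular_part:
  assumes "triangular r f" "X \<in> carrier A" "coef (f (part N X)) v \<noteq> 0"
  shows "\<exists>n\<in>N. r n (path_length v)"
  using assms part_closed[OF assms(2), of N] unfolding triangular_def
  by (metis coef_part)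

lemma part_mult:
  assumes X: "X \<in> carrier A" and Y: "Y \<in> carrier A"
  shows "part {n} (X \<otimes>\<^bsub>A\<^esub> Y) = (\<Oplus>\<^bsub>A\<^esub>i\<in>{..n}. part {i} X \<otimes>\<^bsub>A\<^esub> part {n - i} Y)" (is "_ = ?R")
proof (rule A_eqI)
  show "?R \<in> carrier A" by (rule A.finsum_closed) (use X Y in auto)
next
  fix w assume w: "w \<in> B"
  obtain u p where [simp]: "w = (u, p)" by fastforce
  define t where "t j = coef X (u, take j p) * coef Y (awlast u (take j p), drop j p)" for j
  have "coef ?R w = (\<Sum>i\<le>n. coef (part {i} X \<otimes>\<^bsub>A\<^esub> part {n - i} Y) w)"
    by (rule coef_finsum) (use X Y in auto)
  also have "\<dots> = (\<Sum>i\<le>n. \<Sum>j\<le>length p. if j = i then if length p = n then t j else 0 else 0)"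
  proof (intro sum.cong refl)
    fix i assume i: "i \<in> {..n}"
    have "coef (part {i} X \<otimes>\<^bsub>A\<^esub> part {n - i} Y) w = (\<Sum>j\<le>length p.
      coef (part {i} X) (u, take j p) * coef (part {n - i} Y) (awlast u (take j p), drop j p))"
      using X Y w by (simp add: coef_mult)
    also have "\<dots> = (\<Sum>j\<le>length p. if j = i then if length p = n then t j else 0 else 0)"
    proof (intro sum.cong refl)
      fix j assume j: "j \<in> {..length p}"
      hence "length (take j p) = j" "length (drop j p) = length p - j" by auto
      moreover have "length p - i = n - i \<longleftrightarrow> length p = n" if "i \<le> length p" using that i by auto
      ultimately show "coef (part {i} X) (u, take j p) *
          coef (part {n - i} Y) (awlast u (take j p), drop j p) =
        (if j = i then if length p = n then t j else 0 else 0)"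
        using X Y j by (auto simp: coef_part t_def)
    qed
    finally show "coef (part {i} X \<otimes>\<^bsub>A\<^esub> part {n - i} Y) w =
      (\<Sum>j\<le>length p. if j = i then if length p = n then t j else 0 else 0)" .
  qed
  also have "\<dots> = coef (part {n} (X \<otimes>\<^bsub>A\<^esub> Y)) w"
    using X Y w by (auto simp: coef_mult coef_part t_def intro!: sum.neutral)
  finally show "coef (part {n} (X \<otimes>\<^bsub>A\<^esub> Y)) w = coef ?R w" by simp
qed (use X Y in auto)

text \<open>
  In degree \<open>n\<close>, the product \<open>f X\<^sub>i * f Y\<^sub>n\<^sub>-\<^sub>i\<close> of the images of homogeneous components receives
  contributions from degrees \<open>j\<close> and \<open>n - j\<close> with \<open>r i j\<close> and \<open>r (n - i) (n - j)\<close>. The cancellation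
  property leaves \<open>j = i\<close> only, which is the contribution of \<open>gr f X * gr f Y\<close>.
\<close>

lemma endomorphism_gr:
  assumes f: "endomorphism f" and tri: "triangular r f"
    and cancel: "\<And>i j k l. \<lbrakk>r i j; r k l; i + k = j + l\<rbrakk> \<Longrightarrow> i = j"
  shows "endomorphism (gr Q I f)"
proof -
  note cg = endo_coef_gr[OF f]
  note closed = endo_gr_closed[OF f]
  note f_closed = endo_closed[OF f]
  have "gr Q I f (X \<otimes>\<^bsub>A\<^esub> Y) = gr Q I f X \<otimes>\<^bsub>A\<^esub> gr Q I f Y"
    if X: "X \<in> carrier A" and Y: "Y \<in> carrier A" for X Y
  proof (rule A_eqI)
    fix w assume w: "w \<in> B"
    obtain u p where [simp]: "w = (u, p)" by fastforce
    let ?n = "length p"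
    have "coef (gr Q I f (X \<otimes>\<^bsub>A\<^esub> Y)) w = coef (f (part {?n} (X \<otimes>\<^bsub>A\<^esub> Y))) w"
      using cg[OF mult_closed[OF X Y], of w] by simp
    also have "f (part {?n} (X \<otimes>\<^bsub>A\<^esub> Y)) = (\<Oplus>\<^bsub>A\<^esub>i\<in>{..?n}. f (part {i} X \<otimes>\<^bsub>A\<^esub> part {?n - i} Y))"
      unfolding part_mult[OF X Y] by (rule endo_finsum[OF f]) (use X Y in auto)
    also have "coef \<dots> w = (\<Sum>i\<le>?n. coef (f (part {i} X \<otimes>\<^bsub>A\<^esub> part {?n - i} Y)) w)"
      by (rule coef_finsum) (use X Y f_closed in auto)
    also have "\<dots> = (\<Sum>i\<le>?n. \<Sum>j\<le>?n. coef (f (part {i} X)) (u, take j p) *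
      coef (f (part {?n - i} Y)) (awlast u (take j p), drop j p))"
      using X Y w by (intro sum.cong refl) (simp add: endo_mult[OF f] coef_mult f_closed)
    also have "\<dots> = (\<Sum>i\<le>?n. \<Sum>j\<le>?n. if j = i then coef (f (part {i} X)) (u, take i p) *
      coef (f (part {?n - i} Y)) (awlast u (take i p), drop i p) else 0)"
    proof (intro sum.cong refl)
      fix i j assume ij: "i \<in> {..?n}" "j \<in> {..?n}"
      have "i = j" if "coef (f (part {i} X)) (u, take j p) *
        coef (f (part {?n - i} Y)) (awlast u (take j p), drop j p) \<noteq> 0"
      proof -
        have "r i j" "r (?n - i) (?n - j)"
          using that ij triangular_part[OF tri X, of "{i}" "(u, take j p)"]
            triangular_part[OF tri Y, of "{?n - i}" "(awlast u (take j p), drop j p)"]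
          by (auto simp: min_def split: if_splits)
        thus ?thesis using cancel[of i j "?n - i" "?n - j"] ij by simp
      qed
      thus "coef (f (part {i} X)) (u, take j p) *
          coef (f (part {?n - i} Y)) (awlast u (take j p), drop j p) =
        (if j = i then coef (f (part {i} X)) (u, take i p) *
          coef (f (part {?n - i} Y)) (awlast u (take i p), drop i p) else 0)" by auto
    qed
    also have "\<dots> = (\<Sum>i\<le>?n. coef (gr Q I f X) (u, take i p) *
        coef (gr Q I f Y) (awlast u (take i p), drop i p))"
      by (intro sum.cong refl) (auto simp: cg[OF X] cg[OF Y] min_def)
    also have "\<dots> = coef (gr Q I f X \<otimes>\<^bsub>A\<^esub> gr Q I f Y) w"
      using w X Y closed by (simp add: coef_mult)
    finally show "coef (gr Q I f (X \<otimes>\<^bsub>A\<^esub> Y)) w = coef (gr Q I f X \<otimes>\<^bsub>A\<^esub> gr Q I f Y) w" .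
  qed (use X Y closed in auto)
  moreover have "gr Q I f (X \<oplus>\<^bsub>A\<^esub> Y) = gr Q I f X \<oplus>\<^bsub>A\<^esub> gr Q I f Y"
    if X: "X \<in> carrier A" and Y: "Y \<in> carrier A" for X Y
  proof (rule A_eqI)
    fix w
    have "part {n} (X \<oplus>\<^bsub>A\<^esub> Y) = part {n} X \<oplus>\<^bsub>A\<^esub> part {n} Y" for n
      by (rule A_eqI) (use X Y in \<open>auto simp: coef_part coef_add\<close>)
    thus "coef (gr Q I f (X \<oplus>\<^bsub>A\<^esub> Y)) w = coef (gr Q I f X \<oplus>\<^bsub>A\<^esub> gr Q I f Y) w"
      using X Y closed by (simp add: cg coef_add endo_add[OF f] f_closed add_closed)
  qed (use X Y closed in auto)
  moreover have "gr Q I f (c \<odot>\<^bsub>A\<^esub> X) = c \<odot>\<^bsub>A\<^esub> gr Q I f X" if X: "X \<in> carrier A" for c X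
  proof (rule A_eqI)
    fix w
    have "part {n} (c \<odot>\<^bsub>A\<^esub> X) = c \<odot>\<^bsub>A\<^esub> part {n} X" for n
      by (rule A_eqI) (use X in \<open>auto simp: coef_part coef_smult\<close>)
    thus "coef (gr Q I f (c \<odot>\<^bsub>A\<^esub> X)) w = coef (c \<odot>\<^bsub>A\<^esub> gr Q I f X) w"
      using X closed by (simp add: cg coef_smult endo_smult[OF f] f_closed smult_closed)
  qed (use X closed in auto)
  moreover have "gr Q I f \<one>\<^bsub>A\<^esub> = \<one>\<^bsub>A\<^esub>"
  proof (rule A_eqI)
    fix w :: "('v, 'a) path"
    have p0: "part {0} \<one>\<^bsub>A\<^esub> = \<one>\<^bsub>A\<^esub>"
      by (rule A_eqI) (auto simp: coef_part coef_one)
    have pn: "part {n} \<one>\<^bsub>A\<^esub> = \<zero>\<^bsub>A\<^esub>" if "n \<noteq> 0" for n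
      by (rule A_eqI) (use that in \<open>auto simp: coef_part coef_one coef_zero\<close>)
    show "coef (gr Q I f \<one>\<^bsub>A\<^esub>) w = coef \<one>\<^bsub>A\<^esub> w"
    proof (cases "path_length w = 0")
      case True
      thus ?thesis by (simp add: cg p0 endo_one[OF f])
    next
      case False
      thus ?thesis by (cases w) (simp add: cg pn endo_zero[OF f] coef_zero coef_one)
    qed
  qed (use closed in auto)
  ultimately show ?thesis
    unfolding endomorphism_def using closed by (auto intro!: ring_hom_memI)
qed

lemma gr_preserves_degree:
  assumes f: "endomorphism f" and X: "X \<in> graded_span Q I N"
  shows "gr Q I f X \<in> graded_span Q I N"
proof -
  have Xc: "X \<in> carrier A" using X by (simp add: graded_span_iff)
  have "part {n} X = \<zero>\<^bsub>A\<^esub>" if "n \<notin> N" for n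
  proof (rule A_eqI[OF part_closed[OF Xc] zero_closed])
    fix w :: "('v, 'a) path"
    have "coef X w = 0" if "path_length w = n"
      using X that \<open>n \<notin> N\<close> unfolding graded_span_iff by blast
    thus "coef (part {n} X) w = coef \<zero>\<^bsub>A\<^esub> w" by (simp add: coef_part[OF Xc] coef_zero)
  qed
  hence "coef (gr Q I f X) w = 0" if "path_length w \<notin> N" for w
    using that by (simp add: endo_coef_gr[OF f Xc] endo_zero[OF f] coef_zero)
  thus ?thesis
    unfolding graded_span_iff using endo_gr_closed[OF f Xc] by blast
qed

text \<open>
  For \<open>X\<close> of degree \<open>n\<close>, the components of \<open>g X\<close> outside degree \<open>n\<close> lie strictly \<open>r\<close>-above \<open>n\<close>. By
  antisymmetry \<open>f\<close> cannot map them back to degree \<open>n\<close>, so only \<open>gr g X\<close> contributes.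
\<close>

lemma gr_compose:
  assumes f: "endomorphism f" and g: "endomorphism g" and h: "endomorphism h"
    and tri: "triangular r f" "triangular r g"
    and antisym: "\<And>m n. \<lbrakk>r m n; r n m\<rbrakk> \<Longrightarrow> m = n"
    and X: "X \<in> carrier A" and hfg: "\<And>X. X \<in> carrier A \<Longrightarrow> h X = f (g X)"
  shows "gr Q I h X = gr Q I f (gr Q I g X)"
proof (rule A_eqI)
  have gX: "gr Q I g X \<in> carrier A" by (rule endo_gr_closed[OF g X])
  show "gr Q I h X \<in> carrier A" by (rule endo_gr_closed[OF h X])
  show "gr Q I f (gr Q I g X) \<in> carrier A" by (rule endo_gr_closed[OF f gX])
  fix w :: "('v, 'a) path"
  let ?n = "path_length w"
  define Z where "Z = g (part {?n} X)"
  have Z: "Z \<in> carrier A" unfolding Z_def using X endo_closed[OF g] by blast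
  have "coef (f (part (- {?n}) Z)) w = 0"
  proof (rule ccontr)
    assume "coef (f (part (- {?n}) Z)) w \<noteq> 0"
    then obtain v where v: "coef (part (- {?n}) Z) v \<noteq> 0" "r (path_length v) ?n"
      using tri(1) part_closed[OF Z] unfolding triangular_def by blast
    hence "path_length v \<noteq> ?n" "coef Z v \<noteq> 0" using Z by (auto simp: coef_part split: if_splits)
    thus False using triangular_part[OF tri(2) X, of "{?n}" v] antisym v unfolding Z_def by auto
  qed
  hence "coef (f Z) w = coef (f (part {?n} Z)) w"
    using part_split[OF Z, of "{?n}"] endo_add[OF f, of "part {?n} Z" "part (- {?n}) Z"] Z
      endo_closed[OF f] coef_add[of "f (part {?n} Z)" "f (part (- {?n}) Z)" w]
    by (simp add: part_closed)
  moreover have "part {?n} Z = part {?n} (gr Q I g X)"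
    by (rule A_eqI) (use Z gX in \<open>auto simp: coef_part endo_coef_gr[OF g X] Z_def\<close>)
  ultimately show "coef (gr Q I h X) w = coef (gr Q I f (gr Q I g X)) w"
    using X by (simp add: endo_coef_gr[OF h X] endo_coef_gr[OF f gX] hfg part_closed Z_def)
qed

lemma gr_of_graded:
  assumes f: "endomorphism f" and tri: "triangular (=) f" and X: "X \<in> carrier A"
  shows "gr Q I f X = f X"
proof (rule A_eqI)
  show "gr Q I f X \<in> carrier A" by (rule endo_gr_closed[OF f X])
  show "f X \<in> carrier A" using X by (rule endo_closed[OF f])
  fix w :: "('v, 'a) path"
  let ?n = "path_length w"
  have "coef (f (part (- {?n}) X)) w = 0"
    using triangular_part[OF tri X, of "- {?n}" w] by auto
  thus "coef (gr Q I f X) w = coef (f X) w"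
    using part_split[OF X, of "{?n}"] endo_add[OF f, of "part {?n} X" "part (- {?n}) X"] X
      endo_closed[OF f] coef_add[of "f (part {?n} X)" "f (part (- {?n}) X)" w]
    by (simp add: part_closed endo_coef_gr[OF f X])
qed

section \<open>The exact sequence for triangular automorphisms\<close>

lemma carrier_alg_Aut:
  "f \<in> carrier (alg_Aut A) \<longleftrightarrow> endomorphism f \<and> f \<in> Bij (carrier A)"
  by (auto simp: alg_Aut_def alg_iso_def ring_iso_def endomorphism_def Bij_def)

lemma mult_alg_Aut:
  "\<lbrakk>f \<in> Bij (carrier A); g \<in> Bij (carrier A)\<rbrakk> \<Longrightarrow> f \<otimes>\<^bsub>alg_Aut A\<^esub> g = compose (carrier A) f g"
  by (simp add: alg_Aut_def BijGroup_def)

lemma one_alg_Aut: "\<one>\<^bsub>alg_Aut A\<^esub> = (\<lambda>X \<in> carrier A. X)"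
  by (simp add: alg_Aut_def BijGroup_def)

lemma endomorphism_id: "endomorphism (\<lambda>X \<in> carrier A. X)"
  unfolding endomorphism_def ring_hom_def by auto

lemma endomorphism_compose:
  assumes f: "endomorphism f" and g: "endomorphism g"
  shows "endomorphism (compose (carrier A) f g)"
  unfolding endomorphism_def ring_hom_def
  by (auto simp: compose_def endo_closed[OF f] endo_closed[OF g] endo_add[OF f] endo_add[OF g]
      endo_mult[OF f] endo_mult[OF g] endo_one[OF f] endo_one[OF g] endo_smult[OF f] endo_smult[OF g]
      add_closed mult_closed smult_closed)

lemma group_alg_Aut: "group (alg_Aut A)"
proof -
  have "subgroup (alg_iso A A \<inter> Bij (carrier A)) (BijGroup (carrier A))"
  proof (rule group.subgroupI[OF group_BijGroup])
    show "alg_iso A A \<inter> Bij (carrier A) \<subseteq> carrier (BijGroup (carrier A))"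
      by (simp add: BijGroup_def)
    show "alg_iso A A \<inter> Bij (carrier A) \<noteq> {}"
      using endomorphism_id id_Bij[of "carrier A"] carrier_alg_Aut by (auto simp: alg_Aut_def)
  next
    fix f assume "f \<in> alg_iso A A \<inter> Bij (carrier A)"
    hence f: "endomorphism f" "f \<in> Bij (carrier A)"
      using carrier_alg_Aut[of f] by (auto simp: alg_Aut_def)
    let ?g = "\<lambda>X \<in> carrier A. inv_into (carrier A) f X"
    have closed: "inv_into (carrier A) f X \<in> carrier A" if "X \<in> carrier A" for X
      by (rule Bij_inv_into_mem[OF f(2) that])
    have "endomorphism ?g"
      unfolding endomorphism_def
    proof (intro conjI allI ballI ring_hom_memI)
      fix X Y assume X: "X \<in> carrier A" and Y: "Y \<in> carrier A"
      show "?g (X \<otimes>\<^bsub>A\<^esub> Y) = ?g X \<otimes>\<^bsub>A\<^esub> ?g Y"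
        using X Y Bij_inv_into_lemma[where S = "carrier A" and h = f and g = "mult A" and x = X and y = Y]
          f endo_mult[OF f(1)] by (simp add: mult_closed)
      show "?g (X \<oplus>\<^bsub>A\<^esub> Y) = ?g X \<oplus>\<^bsub>A\<^esub> ?g Y"
        using X Y Bij_inv_into_lemma[where S = "carrier A" and h = f and g = "add A" and x = X and y = Y]
          f endo_add[OF f(1)] by (simp add: add_closed)
    next
      fix c X assume X: "X \<in> carrier A"
      show "?g (c \<odot>\<^bsub>A\<^esub> X) = c \<odot>\<^bsub>A\<^esub> ?g X"
        using X Bij_inv_into_lemma[where S = "carrier A" and h = f
            and g = "\<lambda>_ Y. c \<odot>\<^bsub>A\<^esub> Y" and x = X and y = X]
          f endo_smult[OF f(1)] by (simp add: smult_closed)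
    next
      have "inj_on f (carrier A)" using f(2) by (auto simp: Bij_def bij_betw_def)
      thus "?g \<one>\<^bsub>A\<^esub> = \<one>\<^bsub>A\<^esub>"
        using inv_into_f_f[of f "carrier A" "\<one>\<^bsub>A\<^esub>"] endo_one[OF f(1)] by simp
    qed (use closed in auto)
    moreover have "?g \<in> Bij (carrier A)" by (rule restrict_inv_into_Bij[OF f(2)])
    ultimately show "inv\<^bsub>BijGroup (carrier A)\<^esub> f \<in> alg_iso A A \<inter> Bij (carrier A)"
      using carrier_alg_Aut[of ?g] by (simp add: inv_BijGroup[OF f(2)] alg_Aut_def)
  next
    fix f g assume "f \<in> alg_iso A A \<inter> Bij (carrier A)" "g \<in> alg_iso A A \<inter> Bij (carrier A)"
    hence fg: "endomorphism f" "f \<in> Bij (carrier A)" "endomorphism g" "g \<in> Bij (carrier A)"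
      using carrier_alg_Aut[of f] carrier_alg_Aut[of g] by (auto simp: alg_Aut_def)
    hence "compose (carrier A) f g \<in> carrier (alg_Aut A)"
      by (simp add: carrier_alg_Aut endomorphism_compose compose_Bij)
    thus "f \<otimes>\<^bsub>BijGroup (carrier A)\<^esub> g \<in> alg_iso A A \<inter> Bij (carrier A)"
      using fg by (simp add: BijGroup_def alg_Aut_def)
  qed
  thus ?thesis unfolding alg_Aut_def by (rule subgroup.subgroup_is_group[OF _ group_BijGroup])
qed

lemma carrier_grAut:
  "f \<in> carrier (grAut Q I) \<longleftrightarrow> f \<in> carrier (alg_Aut A) \<and>
    (\<forall>n. f ` graded_span Q I {n} = graded_span Q I {n})"
  by (simp add: grAut_def Let_def)

lemma mult_grAut: "mult (grAut Q I) = mult (alg_Aut A)"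
  and one_grAut: "\<one>\<^bsub>grAut Q I\<^esub> = \<one>\<^bsub>alg_Aut A\<^esub>"
  by (simp_all add: grAut_def Let_def)

lemma graded_span_subset: "graded_span Q I N \<subseteq> carrier A"
  by (auto simp: graded_span_iff)

text \<open>
  Equality in the defining condition \<open>f ` A\<^sub>n = A\<^sub>n\<close> makes closure under inverses immediate.
\<close>

lemma group_grAut: "group (grAut Q I)"
proof -
  interpret Aut: group "alg_Aut A" by (rule group_alg_Aut)
  have "subgroup {f \<in> carrier (alg_Aut A). \<forall>n. f ` graded_span Q I {n} = graded_span Q I {n}} (alg_Aut A)"
    (is "subgroup ?H _")
  proof (rule Aut.subgroupI)
    have "\<one>\<^bsub>alg_Aut A\<^esub> ` graded_span Q I {n} = graded_span Q I {n}" for n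
    proof -
      have "\<one>\<^bsub>alg_Aut A\<^esub> ` graded_span Q I {n} = (\<lambda>X. X) ` graded_span Q I {n}"
        using graded_span_subset[of "{n}"] by (intro image_cong refl) (auto simp: one_alg_Aut)
      thus ?thesis by simp
    qed
    thus "?H \<noteq> {}" using Aut.one_closed by blast
  next
    fix f assume f: "f \<in> ?H"
    let ?g = "inv\<^bsub>alg_Aut A\<^esub> f"
    have Bij: "f \<in> Bij (carrier A)" "?g \<in> Bij (carrier A)"
      using f Aut.inv_closed carrier_alg_Aut by blast+
    have inv_eq: "compose (carrier A) ?g f = (\<lambda>X \<in> carrier A. X)"
      using f Aut.l_inv[of f] by (simp add: mult_alg_Aut Bij one_alg_Aut)
    have gf: "?g (f X) = X" if "X \<in> carrier A" for X
      using fun_cong[OF inv_eq, of X] that by (simp add: compose_def)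
    have "?g ` graded_span Q I {n} = graded_span Q I {n}" for n
    proof -
      have "?g ` graded_span Q I {n} = ?g ` (f ` graded_span Q I {n})" using f by simp
      also have "\<dots> = (\<lambda>X. X) ` graded_span Q I {n}"
        unfolding image_image
        by (rule image_cong[OF refl]) (rule gf, rule subsetD[OF graded_span_subset])
      also have "\<dots> = graded_span Q I {n}" by simp
      finally show ?thesis .
    qed
    thus "?g \<in> ?H" using f by simp
  next
    fix f g assume fg: "f \<in> ?H" "g \<in> ?H"
    have "(f \<otimes>\<^bsub>alg_Aut A\<^esub> g) X = f (g X)" if "X \<in> carrier A" for X
      using fg that by (simp add: carrier_alg_Aut mult_alg_Aut compose_def)
    hence "(f \<otimes>\<^bsub>alg_Aut A\<^esub> g) ` graded_span Q I {n} = f ` (g ` graded_span Q I {n})" for n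
      unfolding image_image
      by (intro image_cong refl) (use subsetD[OF graded_span_subset] in blast)
    thus "f \<otimes>\<^bsub>alg_Aut A\<^esub> g \<in> ?H" using fg by simp
  qed auto
  thus ?thesis unfolding grAut_def Let_def by (rule subgroup.subgroup_is_group[OF _ group_alg_Aut])
qed

lemma gr_extensional: "gr Q I f \<in> extensional (carrier A)"
  by (simp add: gr_def Let_def)

lemma gr_id: "gr Q I \<one>\<^bsub>alg_Aut A\<^esub> = \<one>\<^bsub>alg_Aut A\<^esub>"
proof (rule extensionalityI[OF gr_extensional])
  show "\<one>\<^bsub>alg_Aut A\<^esub> \<in> extensional (carrier A)" by (simp add: one_alg_Aut)
  fix X assume X: "X \<in> carrier A"
  have "triangular (=) (\<lambda>X \<in> carrier A. X)" by (auto simp: triangular_def)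
  thus "gr Q I \<one>\<^bsub>alg_Aut A\<^esub> X = \<one>\<^bsub>alg_Aut A\<^esub> X"
    unfolding one_alg_Aut using gr_of_graded[OF endomorphism_id _ X] by blast
qed

lemma triangular_graded:
  assumes "f \<in> carrier (grAut Q I)"
  shows "triangular (=) f"
proof (rule triangularI)
  show "endomorphism f" using assms by (simp add: carrier_grAut carrier_alg_Aut)
  fix w v assume w: "w \<in> B" and v: "coef (f (path_class Q I w)) v \<noteq> 0"
  have "path_class Q I w \<in> graded_span Q I {path_length w}"
    using w by (auto simp: graded_span_iff path_class_closed coef_path_class)
  hence "f (path_class Q I w) \<in> graded_span Q I {path_length w}"
    using assms by (auto simp: carrier_grAut)
  hence "path_length v \<in> {path_length w}" using v unfolding graded_span_iff by (elim conjE allE[of _ v] impE)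
  thus "path_length w = path_length v" by simp
qed

text \<open>
  The relation \<open>r\<close> has to serve an automorphism and its inverse at the same time: the inverse of \<open>gr f\<close> is obtained as
  \<open>gr\<close> of the inverse of \<open>f\<close>, which uses \<open>gr_compose\<close> for \<open>f\<close> and its inverse.
\<close>

theorem graded_exact_sequence:
  assumes tri: "\<And>f. f \<in> carrier (alg_Aut A) \<Longrightarrow> triangular r f"
    and cancel: "\<And>i j k l. \<lbrakk>r i j; r k l; i + k = j + l\<rbrakk> \<Longrightarrow> i = j"
    and antisym: "\<And>m n. \<lbrakk>r m n; r n m\<rbrakk> \<Longrightarrow> m = n"
  shows "\<forall>f \<in> carrier (alg_Aut A). gr Q I f \<in> carrier (grAut Q I)"
    and "short_exact_sequence (grAut Q I) (alg_Aut A) (Aut0 Q I) (gr Q I) (\<lambda>f. f)"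
proof -
  let ?Aut = "alg_Aut A"
  interpret Aut: group ?Aut by (rule group_alg_Aut)
  interpret grAut: group "grAut Q I" by (rule group_grAut)
  have endo: "endomorphism f" and Bij: "f \<in> Bij (carrier A)" if "f \<in> carrier ?Aut" for f
    using that by (auto simp: carrier_alg_Aut)
  have gr_endo: "endomorphism (gr Q I f)" if "f \<in> carrier ?Aut" for f
    using endo[OF that] tri[OF that] cancel by (rule endomorphism_gr)
  have gr_mult: "gr Q I (f \<otimes>\<^bsub>?Aut\<^esub> g) X = gr Q I f (gr Q I g X)"
    if f: "f \<in> carrier ?Aut" and g: "g \<in> carrier ?Aut" and X: "X \<in> carrier A" for f g X
  proof (rule gr_compose[OF endo[OF f] endo[OF g] _ tri[OF f] tri[OF g] antisym X])
    show "endomorphism (f \<otimes>\<^bsub>?Aut\<^esub> g)" using endo Aut.m_closed[OF f g] by blast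
    fix Y assume "Y \<in> carrier A"
    thus "(f \<otimes>\<^bsub>?Aut\<^esub> g) Y = f (g Y)"
      using Bij[OF f] Bij[OF g] by (simp add: mult_alg_Aut compose_def)
  qed
  have inverse: "gr Q I f (gr Q I (inv\<^bsub>?Aut\<^esub> f) X) = X" "gr Q I (inv\<^bsub>?Aut\<^esub> f) (gr Q I f X) = X"
    if f: "f \<in> carrier ?Aut" and X: "X \<in> carrier A" for f X
    using f X gr_mult[OF f Aut.inv_closed[OF f] X] gr_mult[OF Aut.inv_closed[OF f] f X] gr_id
    by (simp_all add: Aut.r_inv Aut.l_inv one_alg_Aut)
  have gr_Bij: "gr Q I f \<in> Bij (carrier A)" if f: "f \<in> carrier ?Aut" for f
  proof -
    have "bij_betw (gr Q I f) (carrier A) (carrier A)"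
      by (rule bij_betw_byWitness[where f' = "gr Q I (inv\<^bsub>?Aut\<^esub> f)"])
        (use f inverse endo_closed[OF gr_endo] Aut.inv_closed in auto)
    thus ?thesis by (simp add: Bij_def gr_extensional)
  qed
  have gr_span: "gr Q I f ` graded_span Q I {n} = graded_span Q I {n}" if f: "f \<in> carrier ?Aut" for f n
  proof
    show "gr Q I f ` graded_span Q I {n} \<subseteq> graded_span Q I {n}"
      using gr_preserves_degree[OF endo[OF f]] by blast
    show "graded_span Q I {n} \<subseteq> gr Q I f ` graded_span Q I {n}"
    proof
      fix X assume X: "X \<in> graded_span Q I {n}"
      hence "X = gr Q I f (gr Q I (inv\<^bsub>?Aut\<^esub> f) X)"
        using graded_span_subset[of "{n}"] inverse(1)[OF f] by auto
      moreover have "gr Q I (inv\<^bsub>?Aut\<^esub> f) X \<in> graded_span Q I {n}"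
        using X gr_preserves_degree[OF endo[OF Aut.inv_closed[OF f]]] by blast
      ultimately show "X \<in> gr Q I f ` graded_span Q I {n}" by blast
    qed
  qed
  have gr_in: "gr Q I f \<in> carrier (grAut Q I)" if "f \<in> carrier ?Aut" for f
    using that gr_endo gr_Bij gr_span by (simp add: carrier_grAut carrier_alg_Aut)
  thus "\<forall>f \<in> carrier ?Aut. gr Q I f \<in> carrier (grAut Q I)" by blast
  have hom: "gr Q I \<in> hom ?Aut (grAut Q I)"
  proof (rule homI)
    fix f g assume f: "f \<in> carrier ?Aut" and g: "g \<in> carrier ?Aut"
    have "gr Q I (f \<otimes>\<^bsub>?Aut\<^esub> g) = compose (carrier A) (gr Q I f) (gr Q I g)"
      by (rule extensionalityI[OF gr_extensional compose_extensional])
        (simp add: gr_mult[OF f g] compose_def)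
    thus "gr Q I (f \<otimes>\<^bsub>?Aut\<^esub> g) = gr Q I f \<otimes>\<^bsub>grAut Q I\<^esub> gr Q I g"
      by (simp add: mult_grAut mult_alg_Aut gr_Bij f g)
  qed (rule gr_in)
  interpret gr: group_hom ?Aut "grAut Q I" "gr Q I"
    by (simp add: group_hom_def group_hom_axioms_def hom group_alg_Aut group_grAut)
  have kernel: "kernel ?Aut (grAut Q I) (gr Q I) = carrier (Aut0 Q I)"
    by (simp add: kernel_def Aut0_def Let_def one_grAut one_alg_Aut)
  have Aut0: "Aut0 Q I = ?Aut\<lparr>carrier := kernel ?Aut (grAut Q I) (gr Q I)\<rparr>"
    unfolding kernel by (simp add: Aut0_def Let_def)
  have "group (Aut0 Q I)"
    unfolding Aut0 by (rule subgroup.subgroup_is_group[OF gr.subgroup_kernel group_alg_Aut])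
  moreover have incl: "(\<lambda>f. f) \<in> hom (Aut0 Q I) ?Aut"
    by (auto simp: hom_def Aut0 kernel_def)
  ultimately have "group_hom (Aut0 Q I) ?Aut (\<lambda>f. f)"
    by (simp add: group_hom_def group_hom_axioms_def group_alg_Aut)
  hence "exact_seq ([grAut Q I, ?Aut, Aut0 Q I], [gr Q I, \<lambda>f. f])"
    by (intro exact_seq.extension exact_seq.unity group_grAut hom) (simp_all add: kernel)
  moreover have "gr Q I \<in> epi ?Aut (grAut Q I)"
  proof -
    have "carrier (grAut Q I) \<subseteq> gr Q I ` carrier ?Aut"
    proof
      fix f assume f: "f \<in> carrier (grAut Q I)"
      hence fA: "f \<in> carrier ?Aut" by (simp add: carrier_grAut)
      have "gr Q I f = f"
      proof (rule extensionalityI[OF gr_extensional])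
        show "f \<in> extensional (carrier A)" using Bij[OF fA] by (simp add: Bij_def)
      qed (rule gr_of_graded[OF endo[OF fA] triangular_graded[OF f]])
      thus "f \<in> gr Q I ` carrier ?Aut" using fA by (metis image_eqI)
    qed
    thus ?thesis using hom gr_in by (auto simp: epi_def)
  qed
  moreover have "(\<lambda>f. f) \<in> mon (Aut0 Q I) ?Aut"
    using incl by (simp add: mon_def)
  ultimately show "short_exact_sequence (grAut Q I) ?Aut (Aut0 Q I) (gr Q I) (\<lambda>f. f)"
    by (simp only: short_exact_sequence_iff)
qed

lemma leading_term:
  assumes f: "endomorphism f" and tri: "triangular (\<le>) f" and w: "w \<in> B"
  shows "\<exists>Y \<in> graded_span Q I {path_length w<..}.
    f (path_class Q I w) = gr Q I f (path_class Q I w) \<oplus>\<^bsub>A\<^esub> Y"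
proof
  let ?W = "path_class Q I w"
  have W: "?W \<in> carrier A" by (rule path_class_closed[OF w])
  have fW: "f ?W \<in> carrier A" by (rule endo_closed[OF f W])
  let ?Y = "part {path_length w<..} (f ?W)"
  show "?Y \<in> graded_span Q I {path_length w<..}"
    using fW by (auto simp: graded_span_iff coef_part split: if_splits)
  have part: "part {n} ?W = (if n = path_length w then ?W else \<zero>\<^bsub>A\<^esub>)" for n
    by (rule A_eqI) (use W w in \<open>auto simp: coef_part coef_path_class coef_zero\<close>)
  have "gr Q I f ?W \<in> carrier A" by (rule endo_gr_closed[OF f W])
  moreover have "coef (f ?W) v = 0" if "path_length v < path_length w" for v
    using tri W w that unfolding triangular_def
    by (metis coef_path_class leD)
  ultimately show "f ?W = gr Q I f ?W \<oplus>\<^bsub>A\<^esub> ?Y"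
    using fW by (intro A_eqI) (auto simp: coef_add coef_part endo_coef_gr[OF f W] part
        endo_zero[OF f] coef_zero not_less_iff_gr_or_eq add_closed)
qed

section \<open>Automorphisms and the arrow ideal\<close>

lemma path_class_append:
  assumes "(u, p @ q) \<in> paths Q"
  shows "path_class Q I (u, p @ q) = path_class Q I (u, p) \<otimes>\<^bsub>A\<^esub> path_class Q I (awlast u p, q)"
proof -
  have "(path_elem (u, p) :: _ \<Rightarrow> 'k) \<in> carrier P" "(path_elem (awlast u p, q) :: _ \<Rightarrow> 'k) \<in> carrier P"
    using assms by (auto intro!: path_elem_in_path_algebra simp: paths_append_iff)
  thus ?thesis by (simp add: path_class_coset coset_mult path_elem_append)
qed

lemma path_class_in_carrier: "w \<in> paths Q \<Longrightarrow> path_class Q I w \<in> carrier A"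
  by (simp add: path_class_coset path_elem_in_path_algebra coset_carrier)

lemma path_class_zero:
  assumes "w \<in> paths Q" "w \<notin> B"
  shows "path_class Q I w = \<zero>\<^bsub>A\<^esub>"
proof -
  have pe: "(path_elem w :: _ \<Rightarrow> 'k) \<in> carrier P" using assms by (simp add: path_elem_in_path_algebra)
  have "coef (path_class Q I w) v = 0" if "v \<in> B" for v
    unfolding path_class_coset coef_coset[OF pe] using assms that by (auto simp: path_elem_def)
  thus ?thesis
    by (intro A_eqI) (auto simp: coef_zero path_class_in_carrier assms)
qed

text \<open>
  The characters of \<open>A\<close> that factor through the quotient by the arrow ideal.
\<close>

definition vertex_value :: "'v \<Rightarrow> (('v, 'a) path \<Rightarrow> 'k) set \<Rightarrow> 'k" where
  "vertex_value u X = coef X (u, [])"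

lemma vertex_value_mult:
  "\<lbrakk>X \<in> carrier A; Y \<in> carrier A\<rbrakk> \<Longrightarrow>
    vertex_value u (X \<otimes>\<^bsub>A\<^esub> Y) = vertex_value u X * vertex_value u Y"
  by (simp add: vertex_value_def coef_mult coef_outside)

lemma vertex_value_zero: "vertex_value u \<zero>\<^bsub>A\<^esub> = 0"
  by (simp add: vertex_value_def coef_zero)

lemma vertex_value_outside: "vertex_value u X \<noteq> 0 \<Longrightarrow> u \<in> verts Q"
  using coef_basis[of X "(u, [])"] basis_paths_subset start_in_verts[of u "[]"]
  by (auto simp: vertex_value_def)

text \<open>
  The powers of the arrow ideal.
\<close>

abbreviation filtration :: "nat \<Rightarrow> (('v, 'a) path \<Rightarrow> 'k) set set" where
  "filtration n \<equiv> graded_span Q I {n..}"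

lemma graded_spanD: "\<lbrakk>X \<in> graded_span Q I N; coef X w \<noteq> 0\<rbrakk> \<Longrightarrow> path_length w \<in> N"
  by (simp add: graded_span_iff del: split_paired_All)

lemma filtration_carrier: "X \<in> filtration n \<Longrightarrow> X \<in> carrier A"
  by (simp add: graded_span_iff)

lemma filtration_0: "X \<in> filtration 0 \<longleftrightarrow> X \<in> carrier A"
  by (simp add: graded_span_iff)

lemma filtration_1: "X \<in> filtration 1 \<longleftrightarrow> X \<in> carrier A \<and> (\<forall>u. vertex_value u X = 0)"
proof -
  have "(\<forall>w. coef X w \<noteq> 0 \<longrightarrow> path_length w \<in> {1..}) \<longleftrightarrow> (\<forall>u. coef X (u, []) = 0)"
  proof
    assume *: "\<forall>u. coef X (u, []) = 0"
    show "\<forall>w. coef X w \<noteq> 0 \<longrightarrow> path_length w \<in> {1..}"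
    proof (intro allI impI)
      fix w assume "coef X w \<noteq> 0"
      hence "snd w \<noteq> []" using * by (cases w) auto
      thus "path_length w \<in> {1..}" by (cases "snd w") auto
    qed
  qed force
  thus ?thesis by (simp add: graded_span_iff vertex_value_def del: split_paired_All)
qed

lemma filtration_mult:
  assumes X: "X \<in> filtration m" and Y: "Y \<in> filtration n"
  shows "X \<otimes>\<^bsub>A\<^esub> Y \<in> filtration (m + n)"
proof -
  note c = filtration_carrier[OF X] filtration_carrier[OF Y]
  have "m + n \<le> length p" if nz: "coef (X \<otimes>\<^bsub>A\<^esub> Y) (u, p) \<noteq> 0" for u p
  proof -
    obtain i where i: "i \<le> length p" "coef X (u, take i p) * coef Y (awlast u (take i p), drop i p) \<noteq> 0"
      using nz c by (auto simp: coef_mult split: if_splits elim: sum.not_neutral_contains_not_neutral)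
    hence "m \<le> length (take i p)" "n \<le> length (drop i p)"
      using graded_spanD[OF X, of "(u, take i p)"] graded_spanD[OF Y, of "(awlast u (take i p), drop i p)"]
      by auto
    thus ?thesis using i by simp
  qed
  thus ?thesis using c by (simp add: graded_span_iff mult_closed)
qed

lemma filtration_separated:
  assumes "\<And>n. X \<in> filtration n"
  shows "X = \<zero>\<^bsub>A\<^esub>"
proof (rule A_eqI)
  show "X \<in> carrier A" using filtration_carrier[OF assms] .
  fix w show "coef X w = coef \<zero>\<^bsub>A\<^esub> w"
    using graded_spanD[OF assms[of "Suc (path_length w)"], of w] by (auto simp: coef_zero)
qed simp

text \<open>
  A path of length \<open>n\<close> is a product of \<open>n\<close> arrows, so its image lies in the \<open>n\<close>-th power of the arrow
  ideal.
\<close>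

lemma triangular_if_arrows_in_radical:
  assumes f: "endomorphism f"
    and arrows: "\<And>a. a \<in> arcs Q \<Longrightarrow> f (path_class Q I (tail Q a, [a])) \<in> filtration 1"
  shows "triangular (\<le>) f"
proof (rule triangularI[OF f])
  have powers: "f (path_class Q I (u, p)) \<in> filtration (length p)" if "(u, p) \<in> paths Q" for u p
    using that
  proof (induction p arbitrary: u)
    case Nil
    thus ?case using path_class_in_carrier endo_closed[OF f] by (simp only: filtration_0 list.size)
  next
    case (Cons a p)
    hence a: "a \<in> arcs Q" "u = tail Q a" "(head Q a, p) \<in> paths Q" "(u, [a]) \<in> paths Q"
      by (auto simp: paths_Cons_iff)
    have "path_class Q I (u, a # p) = path_class Q I (u, [a]) \<otimes>\<^bsub>A\<^esub> path_class Q I (head Q a, p)"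
      using path_class_append[of u "[a]" p] Cons.prems by simp
    hence "f (path_class Q I (u, a # p)) =
      f (path_class Q I (u, [a])) \<otimes>\<^bsub>A\<^esub> f (path_class Q I (head Q a, p))"
      using a path_class_in_carrier endo_mult[OF f] by metis
    thus ?case using filtration_mult[OF arrows[OF a(1)] Cons.IH[OF a(3)]] a by simp
  qed
  fix w v assume "w \<in> B" "coef (f (path_class Q I w)) v \<noteq> 0"
  moreover have "f (path_class Q I w) \<in> filtration (path_length w)"
    using powers[of "fst w" "snd w"] \<open>w \<in> B\<close> basis_paths_subset by auto
  ultimately show "path_length w \<le> path_length v" using graded_spanD by fastforce
qed

text \<open>
  In the lowest degree of \<open>Y\<close> only the degree zero part of the other factor matters, and it acts
  through its value at the start vertex or at the end vertex of the path.
\<close>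

lemma coef_mult_lowest:
  assumes X: "X \<in> carrier A" and Y: "Y \<in> carrier A"
    and low: "\<And>w. path_length w < length p \<Longrightarrow> coef Y w = 0"
  shows "coef (X \<otimes>\<^bsub>A\<^esub> Y) (u, p) = vertex_value u X * coef Y (u, p)"
    and "coef (Y \<otimes>\<^bsub>A\<^esub> X) (u, p) = coef Y (u, p) * vertex_value (awlast u p) X"
proof -
  have "(\<Sum>i\<le>length p. coef X (u, take i p) * coef Y (awlast u (take i p), drop i p)) =
    (\<Sum>i\<le>length p. if i = 0 then vertex_value u X * coef Y (u, p) else 0)"
    by (intro sum.cong refl) (auto simp: vertex_value_def low)
  thus "coef (X \<otimes>\<^bsub>A\<^esub> Y) (u, p) = vertex_value u X * coef Y (u, p)"
    using X Y by (simp add: coef_mult coef_outside)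
  have "(\<Sum>i\<le>length p. coef Y (u, take i p) * coef X (awlast u (take i p), drop i p)) =
    (\<Sum>i\<le>length p. if i = length p then coef Y (u, p) * vertex_value (awlast u p) X else 0)"
    by (intro sum.cong refl) (auto simp: vertex_value_def low)
  thus "coef (Y \<otimes>\<^bsub>A\<^esub> X) (u, p) = coef Y (u, p) * vertex_value (awlast u p) X"
    using X Y by (simp add: coef_mult coef_outside)
qed

lemma lowest_term:
  assumes X: "X \<in> carrier A" and "X \<noteq> \<zero>\<^bsub>A\<^esub>"
  obtains u p where "coef X (u, p) \<noteq> 0" "\<And>w. path_length w < length p \<Longrightarrow> coef X w = 0"
proof -
  obtain v where "coef X v \<noteq> 0"
    using assms A_eqI[OF X zero_closed] by (auto simp: coef_zero)
  then obtain w where "coef X w \<noteq> 0" "\<And>v. coef X v \<noteq> 0 \<Longrightarrow> path_length w \<le> path_length v"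
    using ex_has_least_nat[of "\<lambda>w. coef X w \<noteq> 0" v path_length] by blast
  thus ?thesis using that[of "fst w" "snd w"] by (metis not_le prod.collapse)
qed

lemma vertex_in_basis: "v \<in> verts Q \<Longrightarrow> (v, []) \<in> B"
  by (rule short_paths_in_basis) auto

lemma vertices_orthogonal:
  assumes "v \<in> verts Q" "v' \<in> verts Q" "v \<noteq> v'"
  shows "path_class Q I (v, []) \<otimes>\<^bsub>A\<^esub> path_class Q I (v', []) = \<zero>\<^bsub>A\<^esub>"
proof (rule A_eqI)
  fix w assume "w \<in> B"
  show "coef (path_class Q I (v, []) \<otimes>\<^bsub>A\<^esub> path_class Q I (v', [])) w = coef \<zero>\<^bsub>A\<^esub> w"
    using assms by (cases w) (auto simp: coef_mult coef_path_class path_class_closed vertex_in_basis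
        coef_zero intro!: sum.neutral)
qed (use assms in \<open>auto intro!: mult_closed path_class_closed vertex_in_basis\<close>)

lemma path_class_nonzero: "w \<in> B \<Longrightarrow> path_class Q I w \<noteq> \<zero>\<^bsub>A\<^esub>"
  using coef_path_class[of w w] coef_zero[of w] by auto

text \<open>
  An idempotent on which all characters vanish lies in every power of the arrow ideal, so it is
  zero; hence each \<open>f e\<^sub>v\<close> has some nonzero value. By orthogonality no vertex serves two distinct \<open>v\<close>.
  Choosing one vertex for each \<open>v\<close> is thus an injection of a finite set into itself, so each vertex is
  taken, and none is left over for a second nonzero value of some \<open>f e\<^sub>v\<close>.
\<close>

lemma vertex_bijection:
  assumes f: "endomorphism f" and inj: "inj_on f (carrier A)"
  obtains \<sigma> where "\<And>v u. v \<in> verts Q \<Longrightarrow>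
    vertex_value u (f (path_class Q I (v, []))) \<noteq> 0 \<longleftrightarrow> u = \<sigma> v"
proof -
  let ?e = "\<lambda>v. path_class Q I (v, [])"
  have e_closed: "?e v \<in> carrier A" if "v \<in> verts Q" for v
    using that by (intro path_class_closed vertex_in_basis)
  have E_closed: "f (?e v) \<in> carrier A" if "v \<in> verts Q" for v
    using endo_closed[OF f e_closed[OF that]] .
  have "\<exists>u. vertex_value u (f (?e v)) \<noteq> 0" if v: "v \<in> verts Q" for v
  proof (rule ccontr)
    let ?E = "f (?e v)"
    assume "\<nexists>u. vertex_value u ?E \<noteq> 0"
    hence E1: "?E \<in> filtration 1" using E_closed[OF v] unfolding filtration_1 by simp
    have "?e v = ?e v \<otimes>\<^bsub>A\<^esub> ?e v" using path_class_append[of v "[]" "[]"] v by simp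
    hence idem: "?E = ?E \<otimes>\<^bsub>A\<^esub> ?E" using endo_mult[OF f e_closed[OF v] e_closed[OF v]] by simp
    \<comment> \<open>An idempotent in the first and in the \<open>n\<close>-th power lies in their product.\<close>
    have "?E \<in> filtration n" for n
    proof (induction n)
      case 0
      show ?case using E_closed[OF v] by (simp only: filtration_0)
    next
      case (Suc n)
      thus ?case using filtration_mult[OF E1 Suc] idem by simp
    qed
    hence "?E = f \<zero>\<^bsub>A\<^esub>" using filtration_separated endo_zero[OF f] by metis
    hence "?e v = \<zero>\<^bsub>A\<^esub>" using inj e_closed[OF v] zero_closed by (auto dest: inj_onD)
    thus False using path_class_nonzero[OF vertex_in_basis[OF v]] by simp
  qed
  then obtain \<sigma> where \<sigma>: "\<And>v. v \<in> verts Q \<Longrightarrow> vertex_value (\<sigma> v) (f (?e v)) \<noteq> 0" by metis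
  have orth: "v = v'" if "v \<in> verts Q" "v' \<in> verts Q"
    "vertex_value u (f (?e v)) \<noteq> 0" "vertex_value u (f (?e v')) \<noteq> 0" for u v v'
  proof (rule ccontr)
    assume "v \<noteq> v'"
    hence "f (?e v) \<otimes>\<^bsub>A\<^esub> f (?e v') = \<zero>\<^bsub>A\<^esub>"
      using that vertices_orthogonal[of v v'] endo_mult[OF f] e_closed endo_zero[OF f] by metis
    hence "vertex_value u (f (?e v)) * vertex_value u (f (?e v')) = 0"
      using vertex_value_mult[of "f (?e v)" "f (?e v')" u] that E_closed vertex_value_zero by simp
    thus False using that by simp
  qed
  have "\<sigma> ` verts Q \<subseteq> verts Q" using \<sigma> vertex_value_outside by blast
  moreover have "inj_on \<sigma> (verts Q)" using \<sigma> orth by (metis inj_onI)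
  ultimately have "\<sigma> ` verts Q = verts Q" by (intro endo_inj_surj) auto
  hence "u = \<sigma> v" if "v \<in> verts Q" "vertex_value u (f (?e v)) \<noteq> 0" for u v
    using that \<sigma> orth vertex_value_outside by (metis imageE)
  thus ?thesis using that \<sigma> by blast
qed

lemma path_class_source:
  assumes "(u, p) \<in> paths Q"
  shows "path_class Q I (u, p) = path_class Q I (u, []) \<otimes>\<^bsub>A\<^esub> path_class Q I (u, p)"
  using path_class_append[of u "[]" p] assms by simp

lemma path_class_target:
  assumes "(u, p) \<in> paths Q"
  shows "path_class Q I (u, p) = path_class Q I (u, p) \<otimes>\<^bsub>A\<^esub> path_class Q I (awlast u p, [])"
  using path_class_append[of u p "[]"] assms by simp

lemma arrow_in_paths: "a \<in> arcs Q \<Longrightarrow> (tail Q a, [a]) \<in> paths Q"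
  by (auto simp: paths_Cons_iff)

text \<open>
  The arrow factors through its end points, whose idempotents have product zero, and the values of
  characters commute.
\<close>

lemma nonloop_in_radical:
  assumes f: "endomorphism f" and a: "a \<in> arcs Q" "tail Q a \<noteq> head Q a"
  shows "f (path_class Q I (tail Q a, [a])) \<in> filtration 1"
proof -
  let ?a = "path_class Q I (tail Q a, [a])"
  let ?s = "path_class Q I (tail Q a, [])"
  let ?t = "path_class Q I (head Q a, [])"
  have closed: "?a \<in> carrier A" "?s \<in> carrier A" "?t \<in> carrier A"
    using a by (auto intro!: path_class_in_carrier simp: arrow_in_paths)
  note f_closed = endo_closed[OF f]
  have "?a = ?s \<otimes>\<^bsub>A\<^esub> ?a" "?a = ?a \<otimes>\<^bsub>A\<^esub> ?t"
    using path_class_source[OF arrow_in_paths[OF a(1)]] path_class_target[OF arrow_in_paths[OF a(1)]]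
    by simp_all
  hence fa: "f ?a = f ?s \<otimes>\<^bsub>A\<^esub> f ?a" "f ?a = f ?a \<otimes>\<^bsub>A\<^esub> f ?t"
    using endo_mult[OF f] closed by metis+
  have "f ?s \<otimes>\<^bsub>A\<^esub> f ?t = \<zero>\<^bsub>A\<^esub>"
    using vertices_orthogonal[of "tail Q a" "head Q a"] a endo_mult[OF f] closed endo_zero[OF f]
    by (metis head_in_verts tail_in_verts)
  hence st: "vertex_value u (f ?s) * vertex_value u (f ?t) = 0" for u
    using vertex_value_mult[of "f ?s" "f ?t" u] f_closed closed vertex_value_zero by simp
  have "vertex_value u (f ?a) = 0" for u
  proof -
    have "vertex_value u (f ?a) = vertex_value u (f ?s) * vertex_value u (f ?a)"
      "vertex_value u (f ?a) = vertex_value u (f ?a) * vertex_value u (f ?t)"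
      using fa vertex_value_mult f_closed closed by metis+
    thus ?thesis using st[of u] by (metis mult_eq_0_iff mult_zero_left)
  qed
  thus ?thesis using f_closed closed unfolding filtration_1 by simp
qed

text \<open>
  Only the value of \<open>f a\<close> at \<open>\<sigma> v\<close> can be nonzero, as \<open>e\<^sub>v a = a\<close>. The lowest term of \<open>f b\<close> starts
  (respectively ends) at \<open>\<sigma> v\<close>, as \<open>e\<^sub>v b = b\<close> (respectively \<open>b e\<^sub>v = b\<close>). Hence the coefficient of \<open>f a f b\<close>
  (respectively \<open>f b f a\<close>) there is the value of \<open>f a\<close> at \<open>\<sigma> v\<close> times a nonzero scalar, and it is zero
  by assumption.
\<close>

lemma loop_in_radical:
  assumes f: "endomorphism f" and inj: "inj_on f (carrier A)"
    and a: "a \<in> arcs Q" "tail Q a = v" "head Q a = v"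
    and b: "(s, [b]) \<in> paths Q"
    and annihilates: "s = v \<and> path_class Q I (v, [a]) \<otimes>\<^bsub>A\<^esub> path_class Q I (s, [b]) = \<zero>\<^bsub>A\<^esub> \<or>
      head Q b = v \<and> path_class Q I (s, [b]) \<otimes>\<^bsub>A\<^esub> path_class Q I (v, [a]) = \<zero>\<^bsub>A\<^esub>"
  shows "f (path_class Q I (v, [a])) \<in> filtration 1"
proof -
  let ?a = "path_class Q I (v, [a])" and ?b = "path_class Q I (s, [b])"
  let ?e = "path_class Q I (v, [])"
  have v: "v \<in> verts Q" using a tail_in_verts by blast
  have ap: "(v, [a]) \<in> paths Q" using arrow_in_paths[OF a(1)] a by simp
  have closed: "?a \<in> carrier A" "?b \<in> carrier A" "?e \<in> carrier A"
    using ap b v by (auto intro!: path_class_in_carrier)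
  note f_closed = endo_closed[OF f closed(1)] endo_closed[OF f closed(2)] endo_closed[OF f closed(3)]
  have "(s, [b]) \<in> B" using b by (intro short_paths_in_basis) auto
  hence "?b \<noteq> \<zero>\<^bsub>A\<^esub>" by (rule path_class_nonzero)
  hence "f ?b \<noteq> \<zero>\<^bsub>A\<^esub>"
    using inj closed zero_closed endo_zero[OF f] by (metis inj_onD)
  then obtain x p where w: "coef (f ?b) (x, p) \<noteq> 0"
      "\<And>w. path_length w < length p \<Longrightarrow> coef (f ?b) w = 0"
    using lowest_term[OF f_closed(2)] by metis
  obtain \<sigma> where \<sigma>: "\<And>v u. v \<in> verts Q \<Longrightarrow>
      vertex_value u (f (path_class Q I (v, []))) \<noteq> 0 \<longleftrightarrow> u = \<sigma> v"
    using vertex_bijection[OF f inj] by blast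
  have "f ?a = f ?e \<otimes>\<^bsub>A\<^esub> f ?a"
    using path_class_source[OF ap] endo_mult[OF f closed(3,1)] by simp
  hence "vertex_value u (f ?a) = vertex_value u (f ?e) * vertex_value u (f ?a)" for u
    using vertex_value_mult[OF f_closed(3,1)] by metis
  hence only: "u = \<sigma> v" if "vertex_value u (f ?a) \<noteq> 0" for u
    using that \<sigma>[OF v, of u] by (metis mult_zero_left)
  have "vertex_value (\<sigma> v) (f ?a) = 0"
    using annihilates
  proof (elim disjE conjE)
    assume "s = v" and ab: "?a \<otimes>\<^bsub>A\<^esub> ?b = \<zero>\<^bsub>A\<^esub>"
    have "f ?b = f ?e \<otimes>\<^bsub>A\<^esub> f ?b"
      using path_class_source[OF b] endo_mult[OF f closed(3,2)] \<open>s = v\<close> by simp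
    hence "coef (f ?b) (x, p) = vertex_value x (f ?e) * coef (f ?b) (x, p)"
      using coef_mult_lowest(1)[OF f_closed(3,2) w(2)] by metis
    hence "x = \<sigma> v" using w(1) \<sigma>[OF v, of x] by auto
    moreover have "f ?a \<otimes>\<^bsub>A\<^esub> f ?b = \<zero>\<^bsub>A\<^esub>"
      using ab endo_mult[OF f closed(1,2)] endo_zero[OF f] by simp
    hence "vertex_value x (f ?a) * coef (f ?b) (x, p) = 0"
      using coef_mult_lowest(1)[OF f_closed(1,2) w(2)] coef_zero by metis
    ultimately show ?thesis using w(1) by simp
  next
    assume "head Q b = v" and ba: "?b \<otimes>\<^bsub>A\<^esub> ?a = \<zero>\<^bsub>A\<^esub>"
    let ?y = "awlast x p"
    have "f ?b = f ?b \<otimes>\<^bsub>A\<^esub> f ?e"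
      using path_class_target[OF b] endo_mult[OF f closed(2,3)] \<open>head Q b = v\<close> by simp
    hence "coef (f ?b) (x, p) = coef (f ?b) (x, p) * vertex_value ?y (f ?e)"
      using coef_mult_lowest(2)[OF f_closed(3,2) w(2)] by metis
    hence "?y = \<sigma> v" using w(1) \<sigma>[OF v, of ?y] by auto
    moreover have "f ?b \<otimes>\<^bsub>A\<^esub> f ?a = \<zero>\<^bsub>A\<^esub>"
      using ba endo_mult[OF f closed(2,1)] endo_zero[OF f] by simp
    hence "coef (f ?b) (x, p) * vertex_value ?y (f ?a) = 0"
      using coef_mult_lowest(2)[OF f_closed(1,2) w(2)] coef_zero by metis
    ultimately show ?thesis using w(1) by simp
  qed
  thus ?thesis using only f_closed by (metis filtration_1)
qed

text \<open>
  Characters vanish on nilpotent elements.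
\<close>

lemma nilpotent_loop_in_radical:
  assumes f: "endomorphism f" and a: "a \<in> arcs Q" "tail Q a = v" "head Q a = v"
    and n: "(v, replicate n a) \<notin> B"
  shows "f (path_class Q I (v, [a])) \<in> filtration 1"
proof -
  let ?a = "path_class Q I (v, [a])"
  have v: "v \<in> verts Q" using a tail_in_verts by blast
  have pow_paths: "(v, replicate m a) \<in> paths Q" for m
    by (induction m) (use a v in \<open>auto simp: paths_Cons_iff\<close>)
  have ac: "?a \<in> carrier A" using pow_paths[of 1] by (simp add: path_class_in_carrier)
  have "vertex_value u (f (path_class Q I (v, replicate (Suc m) a))) = vertex_value u (f ?a) ^ Suc m" for u m
  proof (induction m)
    case 0
    show ?case by simp
  next
    case (Suc m)
    let ?b = "path_class Q I (v, replicate (Suc m) a)"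
    have bc: "?b \<in> carrier A" by (rule path_class_in_carrier[OF pow_paths])
    have "path_class Q I (v, replicate (Suc (Suc m)) a) = ?a \<otimes>\<^bsub>A\<^esub> ?b"
      using path_class_append[of v "[a]" "replicate (Suc m) a"] pow_paths[of "Suc (Suc m)"] a by simp
    hence "vertex_value u (f (path_class Q I (v, replicate (Suc (Suc m)) a))) =
      vertex_value u (f ?a) * vertex_value u (f ?b)"
      by (simp only: endo_mult[OF f ac bc] vertex_value_mult[OF endo_closed[OF f ac] endo_closed[OF f bc]])
    thus ?case using Suc by simp
  qed
  moreover obtain m where "n = Suc m"
    using n vertex_in_basis[OF v] by (cases n) auto
  ultimately have "vertex_value u (f ?a) = 0" for u
    using path_class_zero[OF pow_paths n] endo_zero[OF f] vertex_value_zero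
    by (metis power_eq_0_iff)
  thus ?thesis using endo_closed[OF f ac] unfolding filtration_1 by simp
qed

end

text \<open>
  The only step from \<open>v\<close> in the underlying undirected graph is the loop back to \<open>v\<close>.
\<close>

lemma connected_only_loop:
  assumes wf: "wf_digraph Q" and conn: "connected Q" and a: "a \<in> arcs Q" "tail Q a = v" "head Q a = v"
    and only: "\<And>b. \<lbrakk>b \<in> arcs Q; b \<noteq> a\<rbrakk> \<Longrightarrow> tail Q b \<noteq> v \<and> head Q b \<noteq> v"
  shows "verts Q = {v}" "arcs Q = {a}"
proof -
  interpret wf_digraph Q by (rule wf)
  have v: "v \<in> verts Q" using a tail_in_verts by blast
  have "u = v" if "u \<in> verts Q" for u
  proof -
    have "v \<rightarrow>\<^sup>*\<^bsub>with_proj (mk_symmetric Q)\<^esub> u"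
      using conn v that by (auto simp: connected_def strongly_connected_def)
    hence "(v, u) \<in> (arcs_ends (with_proj (mk_symmetric Q)))\<^sup>*" by (rule reachable_rtranclI)
    thus "u = v"
    proof (induction rule: rtrancl_induct)
      case (step y z)
      hence "(v, z) \<in> parcs (mk_symmetric Q)" by (auto simp: arcs_ends_def arc_to_ends_def)
      then obtain e where e: "e \<in> arcs Q"
          "(v, z) = (tail Q e, head Q e) \<or> (v, z) = (head Q e, tail Q e)"
        by (auto simp: mk_symmetric_def)
      hence "e = a" using only by blast
      thus ?case using e a by auto
    qed simp
  qed
  thus vs: "verts Q = {v}" using v by blast
  have "b = a" if "b \<in> arcs Q" for b
    using only[OF that] tail_in_verts[OF that] vs by auto
  thus "arcs Q = {a}" using a(1) by blast
qed

context monomial_algebra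
begin

text \<open>
  For a loop \<open>a\<close> with \<open>a\<^sup>2\<close> nonzero and another arrow at the same vertex, the string conditions for the
  two continuations of \<open>a\<close> (or the two arrows preceding it) leave no choice but that the mixed product
  vanishes.
\<close>

lemma automorphism_triangular:
  assumes str: "string_conditions Q I" and f: "endomorphism f" and inj: "inj_on f (carrier A)"
    and not_free_loop: "\<not> (\<exists>v a. verts Q = {v} \<and> arcs Q = {a} \<and> B = paths Q)"
  shows "triangular (\<le>) f"
proof (rule triangular_if_arrows_in_radical[OF f])
  fix a assume a: "a \<in> arcs Q"
  have ii: "(path_elem (tail Q b, [b, c]) :: _ \<Rightarrow> 'k) \<in> I \<or> (path_elem (tail Q b', [b', c]) :: _ \<Rightarrow> 'k) \<in> I"
    if "c \<in> arcs Q" "b \<in> arcs Q" "b' \<in> arcs Q" "tail Q c = head Q b" "tail Q c = head Q b'" "b \<noteq> b'" for b b' c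
    using str that unfolding string_conditions_def by blast
  have iii: "(path_elem (tail Q c, [c, b]) :: _ \<Rightarrow> 'k) \<in> I \<or> (path_elem (tail Q c, [c, b']) :: _ \<Rightarrow> 'k) \<in> I"
    if "c \<in> arcs Q" "b \<in> arcs Q" "b' \<in> arcs Q" "head Q c = tail Q b" "head Q c = tail Q b'" "b \<noteq> b'" for b b' c
    using str that unfolding string_conditions_def by blast
  have conn: "connected Q" using str by (simp add: string_conditions_def quiver_def)
  show "f (path_class Q I (tail Q a, [a])) \<in> filtration 1"
  proof (cases "tail Q a = head Q a")
    case False
    thus ?thesis by (rule nonloop_in_radical[OF f a])
  next
    case True
    define v where "v = tail Q a"
    have av: "tail Q a = v" "head Q a = v" using True by (simp_all add: v_def)
    have zero: "path_class Q I (tail Q b, [b]) \<otimes>\<^bsub>A\<^esub> path_class Q I (tail Q c, [c]) = \<zero>\<^bsub>A\<^esub>"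
      if "b \<in> arcs Q" "c \<in> arcs Q" "head Q b = tail Q c" "(path_elem (tail Q b, [b, c]) :: _ \<Rightarrow> 'k) \<in> I" for b c
    proof -
      have "(tail Q b, [b] @ [c]) \<in> paths Q" using that by (auto simp: paths_Cons_iff)
      moreover have "(tail Q b, [b] @ [c]) \<notin> B" using that by (simp add: basis_paths_def)
      ultimately show ?thesis
        using path_class_append path_class_zero that by fastforce
    qed
    show ?thesis
    proof (cases "\<exists>n. (v, replicate n a) \<notin> B")
      case True
      thus ?thesis using nilpotent_loop_in_radical[OF f a av] av by auto
    next
      case False
      hence pow: "(v, replicate n a) \<in> B" for n by blast
      hence "(v, [a, a]) \<in> B" using pow[of 2] by (simp add: numeral_2_eq_2)
      hence aa: "(path_elem (v, [a, a]) :: _ \<Rightarrow> 'k) \<notin> I" by (simp add: basis_paths_def)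
      show ?thesis
      proof (cases "\<exists>b \<in> arcs Q. b \<noteq> a \<and> (tail Q b = v \<or> head Q b = v)")
        case True
        then obtain b where b: "b \<in> arcs Q" "b \<noteq> a" "tail Q b = v \<or> head Q b = v" by blast
        from b(3) have "tail Q b = v \<and> path_class Q I (v, [a]) \<otimes>\<^bsub>A\<^esub> path_class Q I (tail Q b, [b]) = \<zero>\<^bsub>A\<^esub> \<or>
          head Q b = v \<and> path_class Q I (tail Q b, [b]) \<otimes>\<^bsub>A\<^esub> path_class Q I (v, [a]) = \<zero>\<^bsub>A\<^esub>"
        proof
          assume "tail Q b = v"
          thus ?thesis using iii[of a a b] zero[of a b] aa a b av by auto
        next
          assume "head Q b = v"
          thus ?thesis using ii[of a a b] zero[of b a] aa a b av by auto
        qed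
        thus ?thesis
          using loop_in_radical[OF f inj a av, of "tail Q b" b] arrow_in_paths[OF b(1)] av by simp
      next
        case False
        hence single: "verts Q = {v}" "arcs Q = {a}"
          using connected_only_loop[OF wf_digraph conn a av] by blast+
        have "p = replicate (length p) a" if "(u, p) \<in> paths Q" for u p
          using that by (induction p arbitrary: u) (auto simp: paths_Cons_iff single)
        hence "w \<in> B" if "w \<in> paths Q" for w
          using that pow start_in_verts[of "fst w" "snd w"] single by (metis prod.collapse singletonD)
        hence "B = paths Q" using basis_paths_subset by blast
        thus ?thesis using not_free_loop single by blast
      qed
    qed
  qed
qed

end

section \<open>The polynomial algebra\<close>

text \<open>
  Such a map is the substitution of \<open>g x\<close> for \<open>x\<close>, which multiplies degrees by the degree of \<open>g x\<close>. As
  \<open>x\<close> itself is attained and has degree one, so has \<open>g x\<close>.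
\<close>

lemma degree_surjective_poly_endo:
  fixes g :: "'k::field poly \<Rightarrow> 'k poly"
  assumes add: "\<And>p q. g (p + q) = g p + g q" and mult: "\<And>p q. g (p * q) = g p * g q"
    and const: "\<And>c. g [:c:] = [:c:]" and surj: "surj g"
  shows "degree (g p) = degree p"
proof -
  let ?x = "[:0, 1:] :: 'k poly"
  have g: "g p = pcompose p (g ?x)" for p
  proof (induction p)
    case 0
    thus ?case using const[of 0] by simp
  next
    case (pCons a p)
    have "pCons a p = [:a:] + ?x * p" by simp
    hence "g (pCons a p) = [:a:] + g ?x * g p" by (metis add mult const)
    thus ?case using pCons by (simp add: pcompose_pCons)
  qed
  obtain q where "g q = ?x" using surj by (metis surjD)
  hence "degree q * degree (g ?x) = degree ?x" using g[of q] degree_pcompose by metis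
  hence "degree (g ?x) = 1" by simp
  thus ?thesis using g[of p] degree_pcompose[of p "g ?x"] by simp
qed

locale free_loop = monomial_algebra Q I S
  for Q :: "('v, 'a) pre_digraph" and I :: "(('v, 'a) path \<Rightarrow> 'k::field) set" and S +
  fixes v :: 'v and a :: 'a
  assumes verts_eq: "verts Q = {v}" and arcs_eq: "arcs Q = {a}" and all_basis: "B = paths Q"
begin

lemma loop: "tail Q a = v" "head Q a = v"
  using tail_in_verts[of a] head_in_verts[of a] by (simp_all add: verts_eq arcs_eq)

lemma awlast_power [simp]: "awlast v (replicate n a) = v"
  by (induction n) (auto simp: loop)

lemma power_in_paths: "(v, replicate n a) \<in> paths Q"
  by (induction n) (auto simp: paths_Cons_iff verts_eq arcs_eq loop)

lemma paths_powers: "w \<in> paths Q \<Longrightarrow> w = (v, replicate (path_length w) a)"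
proof -
  have "p = replicate (length p) a" if "(u, p) \<in> paths Q" for u p
    using that by (induction p arbitrary: u) (auto simp: paths_Cons_iff arcs_eq)
  thus "w \<in> paths Q \<Longrightarrow> w = (v, replicate (path_length w) a)"
    using start_in_verts[of "fst w" "snd w"] by (cases w) (auto simp: verts_eq)
qed

definition to_poly :: "(('v, 'a) path \<Rightarrow> 'k) set \<Rightarrow> 'k poly" where
  "to_poly X = Abs_poly (\<lambda>n. coef X (v, replicate n a))"

lemma coeff_to_poly:
  assumes "X \<in> carrier A"
  shows "coeff (to_poly X) n = coef X (v, replicate n a)"
proof -
  have "finite (path_length ` {w. coef X w \<noteq> 0})" using coef_finite[OF assms] by simp
  then obtain N where N: "\<forall>m \<in> path_length ` {w. coef X w \<noteq> 0}. m \<le> N"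
    using finite_nat_set_iff_bounded_le by blast
  have "coef X (v, replicate m a) = 0" if "m > N" for m
    using N that by fastforce
  hence "coeff (Abs_poly (\<lambda>n. coef X (v, replicate n a))) = (\<lambda>n. coef X (v, replicate n a))"
    by (rule coeff_Abs_poly)
  thus ?thesis unfolding to_poly_def by (rule fun_cong)
qed

lemma to_poly_inj:
  assumes "X \<in> carrier A" "Y \<in> carrier A" "to_poly X = to_poly Y"
  shows "X = Y"
proof (rule A_eqI[OF assms(1,2)])
  fix w assume "w \<in> B"
  hence "w = (v, replicate (path_length w) a)" using all_basis paths_powers by blast
  thus "coef X w = coef Y w" using assms coeff_to_poly by metis
qed

lemma to_poly_surj: "\<exists>X \<in> carrier A. to_poly X = p"
proof -
  define x where "x = (\<lambda>w. if w \<in> B then coeff p (path_length w) else 0)"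
  have "{w. x w \<noteq> 0} \<subseteq> (\<lambda>n. (v, replicate n a)) ` {..degree p}"
  proof
    fix w assume "w \<in> {w. x w \<noteq> 0}"
    hence "w \<in> B" "path_length w \<le> degree p" by (auto simp: x_def le_degree split: if_splits)
    thus "w \<in> (\<lambda>n. (v, replicate n a)) ` {..degree p}" using paths_powers all_basis by blast
  qed
  hence "finite {w. x w \<noteq> 0}" by (rule finite_subset) simp
  hence X: "coset x \<in> carrier A" "coef (coset x) = x"
    by (auto intro!: element_with_coefs simp: x_def split: if_splits)
  have "to_poly (coset x) = p"
    by (rule poly_eqI) (use X power_in_paths all_basis in \<open>simp add: coeff_to_poly x_def\<close>)
  thus ?thesis using X by blast
qed

lemma to_poly_add:
  "\<lbrakk>X \<in> carrier A; Y \<in> carrier A\<rbrakk> \<Longrightarrow> to_poly (X \<oplus>\<^bsub>A\<^esub> Y) = to_poly X + to_poly Y"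
  by (rule poly_eqI) (simp add: coeff_to_poly coef_add add_closed)

lemma to_poly_mult:
  "\<lbrakk>X \<in> carrier A; Y \<in> carrier A\<rbrakk> \<Longrightarrow> to_poly (X \<otimes>\<^bsub>A\<^esub> Y) = to_poly X * to_poly Y"
  by (rule poly_eqI) (auto simp: coeff_to_poly coef_mult mult_closed power_in_paths all_basis coeff_mult
      min_absorb1 intro!: sum.cong)

lemma to_poly_smult:
  "X \<in> carrier A \<Longrightarrow> to_poly (c \<odot>\<^bsub>A\<^esub> X) = Polynomial.smult c (to_poly X)"
  by (rule poly_eqI) (simp add: coeff_to_poly coef_smult smult_closed)

lemma to_poly_one: "to_poly \<one>\<^bsub>A\<^esub> = 1"
  by (rule poly_eqI) (simp add: coeff_to_poly coef_one verts_eq one_closed)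

lemma polynomial_iso: "to_poly \<in> alg_iso A polynomial_algebra"
proof -
  have "to_poly \<in> ring_hom A polynomial_algebra"
    by (rule ring_hom_memI)
      (simp_all add: polynomial_algebra_def to_poly_add to_poly_mult to_poly_one)
  moreover have "inj_on to_poly (carrier A)" by (rule inj_onI) (rule to_poly_inj)
  moreover have "to_poly ` carrier A = UNIV"
  proof (intro equalityI subset_UNIV subsetI)
    fix p obtain X where "X \<in> carrier A" "to_poly X = p" using to_poly_surj by blast
    thus "p \<in> to_poly ` carrier A" by (rule rev_image_eqI[OF _ sym])
  qed
  ultimately show ?thesis
    unfolding alg_iso_def ring_iso_def bij_betw_def
    by (simp add: polynomial_algebra_def to_poly_smult)
qed

lemma automorphism_preserves_degree:
  assumes f: "endomorphism f" and surj: "f ` carrier A = carrier A"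
  shows "triangular (\<ge>) f"
  unfolding triangular_def
proof (intro ballI allI impI)
  \<comment> \<open>The transported map on polynomials is a surjective algebra endomorphism.\<close>
  define from_poly where "from_poly p = (SOME X. X \<in> carrier A \<and> to_poly X = p)" for p
  have fp: "from_poly p \<in> carrier A" "to_poly (from_poly p) = p" for p
    using someI_ex[of "\<lambda>X. X \<in> carrier A \<and> to_poly X = p"] to_poly_surj[of p]
    unfolding from_poly_def by blast+
  have from_to: "from_poly (to_poly X) = X" if "X \<in> carrier A" for X
    by (rule to_poly_inj[OF fp(1) that fp(2)])
  have from_add: "from_poly (p + q) = from_poly p \<oplus>\<^bsub>A\<^esub> from_poly q" for p q
    by (rule to_poly_inj) (simp_all add: fp to_poly_add add_closed)
  have from_mult: "from_poly (p * q) = from_poly p \<otimes>\<^bsub>A\<^esub> from_poly q" for p q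
    by (rule to_poly_inj) (simp_all add: fp to_poly_mult mult_closed)
  have from_const: "from_poly [:c:] = c \<odot>\<^bsub>A\<^esub> \<one>\<^bsub>A\<^esub>" for c
    by (rule to_poly_inj) (simp_all add: fp to_poly_smult to_poly_one one_closed smult_closed smult_one)
  note f_closed = endo_closed[OF f]
  have deg: "degree (to_poly (f (from_poly p))) = degree p" for p
  proof (rule degree_surjective_poly_endo)
    show "to_poly (f (from_poly (p + q))) = to_poly (f (from_poly p)) + to_poly (f (from_poly q))" for p q
      by (simp add: from_add endo_add[OF f] fp to_poly_add f_closed)
    show "to_poly (f (from_poly (p * q))) = to_poly (f (from_poly p)) * to_poly (f (from_poly q))" for p q
      by (simp add: from_mult endo_mult[OF f] fp to_poly_mult f_closed)
    show "to_poly (f (from_poly [:c:])) = [:c:]" for c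
      by (simp add: from_const endo_smult[OF f] endo_one[OF f] one_closed to_poly_smult to_poly_one smult_one)
    show "surj (\<lambda>p. to_poly (f (from_poly p)))"
    proof (rule surjI)
      fix p
      show "to_poly (f (from_poly (to_poly (inv_into (carrier A) f (from_poly p))))) = p"
        using surj fp[of p] from_to inv_into_into[of "from_poly p" f "carrier A"]
          f_inv_into_f[of "from_poly p" f "carrier A"] by simp
    qed
  qed
  fix X w assume X: "X \<in> carrier A" and w: "coef (f X) w \<noteq> 0"
  have wp: "w = (v, replicate (path_length w) a)"
    using coef_basis[OF w] all_basis paths_powers by blast
  have "coeff (to_poly (f X)) (path_length w) \<noteq> 0"
    using w wp coeff_to_poly[OF f_closed[OF X]] by metis
  hence "path_length w \<le> degree (to_poly (f X))" by (rule le_degree)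
  also have "\<dots> = degree (to_poly X)" using deg[of "to_poly X"] from_to[OF X] by simp
  finally have le: "path_length w \<le> degree (to_poly X)" .
  have "to_poly X \<noteq> 0"
  proof
    assume "to_poly X = 0"
    hence "X = \<zero>\<^bsub>A\<^esub>"
      by (intro to_poly_inj[OF X zero_closed] poly_eqI) (simp add: coeff_to_poly coef_zero zero_closed)
    thus False using w endo_zero[OF f] coef_zero by simp
  qed
  hence "coef X (v, replicate (degree (to_poly X)) a) \<noteq> 0"
    using coeff_to_poly[OF X, symmetric] by simp
  thus "\<exists>u. coef X u \<noteq> 0 \<and> path_length u \<ge> path_length w"
    using le by (intro exI[of _ "(v, replicate (degree (to_poly X)) a)"]) simp
qed

end

text \<open>
  The relation \<open>r\<close> is \<open>\<ge>\<close> for the free loop, where the last claim holds vacuously because \<open>A\<close> is a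
  polynomial algebra, and \<open>\<le>\<close> in all other cases.
\<close>

theorem lemma1p1:
  fixes Q :: "('v, 'a) pre_digraph"
    and I :: "(('v, 'a) path \<Rightarrow> 'k::field) set"
  assumes "string_algebra Q I \<or> locally_string_algebra Q I"
  shows "(\<forall>f \<in> carrier (alg_Aut (bound_quiver_algebra Q I)). gr Q I f \<in> carrier (grAut Q I)) \<and>
    short_exact_sequence
      (grAut Q I) (alg_Aut (bound_quiver_algebra Q I)) (Aut0 Q I) (gr Q I) (\<lambda>f. f) \<and>
    (alg_iso (bound_quiver_algebra Q I) (polynomial_algebra :: ('k, 'k poly) module) = {} \<longrightarrow>
      (\<forall>f \<in> carrier (alg_Aut (bound_quiver_algebra Q I)). \<forall>w \<in> basis_paths Q I.
        \<exists>Y \<in> graded_span Q I {path_length w<..}.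
          f (path_class Q I w) =
            gr Q I f (path_class Q I w) \<oplus>\<^bsub>bound_quiver_algebra Q I\<^esub> Y))"
proof -
  have str: "string_conditions Q I"
    using assms by (auto simp: string_algebra_def locally_string_algebra_def)
  then obtain S where "S \<subseteq> {w \<in> paths Q. 2 \<le> path_length w}" "I = Idl\<^bsub>path_algebra Q\<^esub> (path_elem ` S)"
    unfolding string_conditions_def by blast
  moreover have "fin_digraph Q" using str by (simp add: string_conditions_def quiver_def)
  ultimately interpret monomial_algebra Q I S
    by (simp add: monomial_algebra_def monomial_algebra_axioms_def)
  have aut: "endomorphism f" "inj_on f (carrier A)" "f ` carrier A = carrier A"
    if "f \<in> carrier (alg_Aut A)" for f
    using that by (auto simp: carrier_alg_Aut Bij_def bij_betw_def)
  show ?thesis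
  proof (cases "\<exists>v a. verts Q = {v} \<and> arcs Q = {a} \<and> B = paths Q")
    case True
    then obtain v a where "verts Q = {v}" "arcs Q = {a}" "B = paths Q" by blast
    then interpret free_loop Q I S v a by unfold_locales
    have tri: "triangular (\<ge>) f" if "f \<in> carrier (alg_Aut A)" for f
      using automorphism_preserves_degree aut[OF that] by blast
    show ?thesis
      using graded_exact_sequence[of "(\<ge>)", OF tri] polynomial_iso by auto
  next
    case False
    have tri: "triangular (\<le>) f" if "f \<in> carrier (alg_Aut A)" for f
      using automorphism_triangular[OF str _ _ False] aut[OF that] by blast
    have "\<exists>Y \<in> graded_span Q I {path_length w<..}.
        f (path_class Q I w) = gr Q I f (path_class Q I w) \<oplus>\<^bsub>A\<^esub> Y"
      if "f \<in> carrier (alg_Aut A)" "w \<in> B" for f w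
      using leading_term[OF aut(1)[OF that(1)] tri[OF that(1)] that(2)] .
    thus ?thesis
      using graded_exact_sequence[of "(\<le>)", OF tri] by auto
  qed
qed

end
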